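(* Let $\Omega\subset\mathbb{R}^d$ be an unbounded domain with a sufficiently smooth boundary such that for every $D>0$ there exists a point $h_D\in\Omega$ with $d(h_D,\partial\Omega)\ge D$, and let $f\in C(\mathbb{R},\mathbb{R})$ satisfy $f(u)u\ge -C+|u|^{2+\varepsilon}$ for all $u\in\mathbb{R}$, with some constants $C$ and $\varepsilon>0$. Let $\mathcal{K}$ be the set of all bounded solutions $u\in C_b(\mathbb{R}^d)$ of $\Delta u-f(u)=0$ defined for all $x\in\mathbb{R}^d$. Then there exists a monotone decreasing function $\alpha:\mathbb{R}_+\to\mathbb{R}_+$ with $\lim_{z\to\infty}\alpha(z)=0$ such that, for every solution $u\in C_b(\Omega)$ of the problem $$\Delta u-f(u)=0\ \text{ in }\Omega,\qquad u\big|_{\partial\Omega}=u_0,$$ with arbitrary boundary data $u_0\in C_b(\partial\Omega)$, the estimate $$d_{C(B^1_x)}\big(u|_{B^1_x},\mathcal{K}|_{B^1_x}\big)\le\alpha\big(d(x,\partial\Omega)\big)$$ holds for all $x\in\Omega$ with $d(x,\partial\Omega)>2$. The function $\alpha$ is independent of $u$ and of $x\in\Omega$.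
   Context: $C_b(V)$ is the space of bounded continuous functions on $V$ with the sup norm. Solutions of the elliptic equation are understood in the weak (distributional) sense. $d(x,V)$ is the Euclidean distance from $x$ to $V$ in $\mathbb{R}^d$ (with $d(x,\emptyset)=+\infty$ and $\alpha(+\infty):=0$). $B^1_x$ is the ball of radius $1$ in $\mathbb{R}^d$ centered at $x$; $\mathcal{K}|_{B^1_x}$ is the set of restrictions to $B^1_x$ of the elements of $\mathcal{K}$; $d_{C(B^1_x)}(p,U)=\inf_{v\in U}\|p-v\|_{C(B^1_x)}$ is the distance from the point $p$ to the set $U$ in the sup norm on $B^1_x$. *)

theory Defs
  imports "HOL-Analysis.Analysis"
begin

definition Cb :: "'a::topological_space set \<Rightarrow> ('a \<Rightarrow> real) set" where
  "Cb V = {u. continuous_on V u \<and> bounded (u ` V)}"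

definition dir_deriv :: "'a \<Rightarrow> ('a::euclidean_space \<Rightarrow> real) \<Rightarrow> 'a \<Rightarrow> real" where
  "dir_deriv v g x = frechet_derivative g (at x) v"

definition laplacian :: "('a::euclidean_space \<Rightarrow> real) \<Rightarrow> 'a \<Rightarrow> real" where
  "laplacian g x = (\<Sum>i\<in>Basis. dir_deriv i (dir_deriv i g) x)"

(* Intended for open S only: dir_deriv uses the full neighbourhood of a point. *)
primrec Ck_on :: "nat \<Rightarrow> ('a::euclidean_space \<Rightarrow> real) \<Rightarrow> 'a set \<Rightarrow> bool" where
  "Ck_on 0 g S \<longleftrightarrow> continuous_on S g"
| "Ck_on (Suc k) g S \<longleftrightarrow> g differentiable_on S \<and> (\<forall>i\<in>Basis. Ck_on k (dir_deriv i g) S)"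

definition test_function :: "'a::euclidean_space set \<Rightarrow> ('a \<Rightarrow> real) \<Rightarrow> bool" where
  "test_function V \<phi> \<longleftrightarrow> (\<forall>k. Ck_on k \<phi> UNIV) \<and>
     compact (closure {x. \<phi> x \<noteq> 0}) \<and> closure {x. \<phi> x \<noteq> 0} \<subseteq> V"

(* Distributional form of the equation (Laplacian of u) - f(u) = 0 in the open set V,
   for functions u that are continuous on V. The values of u outside V are irrelevant. *)
definition weak_solution :: "(real \<Rightarrow> real) \<Rightarrow> 'a::euclidean_space set \<Rightarrow> ('a \<Rightarrow> real) \<Rightarrow> bool" where
  "weak_solution f V u \<longleftrightarrow> (\<forall>\<phi>. test_function V \<phi> \<longrightarrow>
     (LINT x:V|lborel. u x * laplacian \<phi> x) - (LINT x:V|lborel. f (u x) * \<phi> x) = 0)"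

definition entire_solutions :: "(real \<Rightarrow> real) \<Rightarrow> ('a::euclidean_space \<Rightarrow> real) set" where
  "entire_solutions f = {u \<in> Cb UNIV. weak_solution f UNIV u}"

(* Near each boundary point, \<Omega> is the strict epigraph, in the direction of some unit vector e,
   of a C^k function of the remaining d - 1 coordinates. A function of those coordinates is
   encoded as a function on the whole space evaluated at the orthogonal projection
   x - (x \<bullet> e) e of x onto the hyperplane orthogonal to e. *)
definition Ck_boundary :: "nat \<Rightarrow> 'a::euclidean_space set \<Rightarrow> bool" where
  "Ck_boundary k \<Omega> \<longleftrightarrow> (\<forall>y \<in> frontier \<Omega>. \<exists>r e \<gamma>. r > 0 \<and> norm e = 1 \<and> Ck_on k \<gamma> UNIV \<and>
     \<Omega> \<inter> ball y r = {x \<in> ball y r. x \<bullet> e > \<gamma> (x - (x \<bullet> e) *\<^sub>R e)})"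

(* Equal to \<infinity> for V = {}, unlike infdist. *)
definition edist_set :: "'a::metric_space \<Rightarrow> 'a set \<Rightarrow> ereal" where
  "edist_set x V = (INF y\<in>V. ereal (dist x y))"

definition sup_norm_on :: "'a set \<Rightarrow> ('a \<Rightarrow> real) \<Rightarrow> ereal" where
  "sup_norm_on S g = (SUP y\<in>S. ereal \<bar>g y\<bar>)"

definition sup_dist_set :: "'a set \<Rightarrow> ('a \<Rightarrow> real) \<Rightarrow> ('a \<Rightarrow> real) set \<Rightarrow> ereal" where
  "sup_dist_set S p U = (INF v\<in>U. sup_norm_on S (\<lambda>y. p y - v y))"

(* Extension of \<alpha> from [0,\<infinity>) to [0,\<infinity>] by \<alpha>(\<infinity>) = 0. *)
definition extend_at_infinity :: "(real \<Rightarrow> real) \<Rightarrow> ereal \<Rightarrow> ereal" where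
  "extend_at_infinity \<alpha> z = (if z = \<infinity> then 0 else ereal (\<alpha> (real_of_ereal z)))"

end

theory Submission
  imports Defs "HOL-Complex_Analysis.Great_Picard"
begin

text \<open>
The growth condition on $f$ makes every solution forget the boundary. If the equation holds in a
ball of radius 1 around a point, then the modulus of the solution there is at most a constant that
depends on $f$ and the dimension only (\<open>weak_solution_interior_bound\<close>, the estimate of Keller and
Osserman): the function $A (1 - |y|^2)^{-p}$ blows up at the unit sphere and is a strict
supersolution once $p \varepsilon \ge 2$ and $A$ is large, so that it dominates all solutions from
above; a change of sign gives the bound from below.
With $u$ and hence $f(u)$ bounded, $u$ has an interior Lipschitz bound
(\<open>weak_solution_interior_lipschitz\<close>): the difference of $u$ and its mirror image in a coordinate
hyperplane vanishes on that hyperplane and is compared with a quadratic polynomial in a half ball.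

Suppose that $u_n$ solves the equation in the ball of radius $n$ around $x_n$. The translates
$u_n(\cdot + x_n)$ are then uniformly bounded and uniformly Lipschitz on each fixed ball as soon as
$n$ is large, so a subsequence converges locally uniformly. The weak form of the equation passes to
the limit, and the limit is a bounded entire solution. Hence for every $\eta > 0$ there is a radius
$R$, depending on $f$, $\eta$ and the dimension only, such that each solution in a ball of radius
$R$ is within $\eta$ of an entire solution on the concentric unit ball
(\<open>approximation_by_entire_solutions\<close>). The function $\alpha(z)$ is the infimum of all
$\eta$ that work for the balls of radius at least $z$; a point at distance $r$ from the boundary is the centre of a ball of
radius $r$ inside the domain.

Solutions are merely continuous and satisfy the equation in the sense of distributions, while both
estimates rest on the maximum principle. The bridge is \<open>weak_solution_approximation\<close>: averaging
$u$ against a smooth bump gives a function that is uniformly close to $u$ and whose Laplacian is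
uniformly close to $f(u)$. At an interior maximum only second differences along the coordinate
axes are compared, so the Laplacian is taken as a limit of symmetric second differences; these
pass directly from the averaged function to the bump.
\<close>

section \<open>Test functions\<close>

lemma dir_deriv_eq:
  assumes "(g has_derivative D) (at x)"
  shows "dir_deriv v g x = D v"
  using frechet_derivative_at[OF assms] by (simp add: dir_deriv_def)

lemma has_derivative_dir_deriv:
  assumes "g differentiable (at x)"
  shows "(g has_derivative (\<lambda>v. dir_deriv v g x)) (at x)"
  using assms frechet_derivative_works[of g "at x"] by (simp add: dir_deriv_def)

lemma Ck_on_Suc_imp: "Ck_on (Suc k) g UNIV \<Longrightarrow> Ck_on k g UNIV"
proof (induction k arbitrary: g)
  case 0
  then show ?case by (simp add: differentiable_imp_continuous_on)
next
  case (Suc k)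
  then show ?case by auto
qed

lemma Ck_on_const: "Ck_on k (\<lambda>x. c) UNIV"
proof (induction k arbitrary: c)
  case (Suc k)
  have "dir_deriv v (\<lambda>x::'a. c) = (\<lambda>x. 0)" for v
    by (rule ext) (simp add: dir_deriv_eq[OF has_derivative_const])
  then show ?case using Suc by simp
qed simp

lemma Ck_on_inner: "Ck_on k (\<lambda>x. x \<bullet> c) UNIV"
proof (cases k)
  case (Suc k)
  have d: "((\<lambda>x::'a. x \<bullet> c) has_derivative (\<lambda>v. v \<bullet> c)) (at x)" for x
    by (auto intro!: derivative_eq_intros)
  have "dir_deriv v (\<lambda>x::'a. x \<bullet> c) = (\<lambda>x. v \<bullet> c)" for v
    by (rule ext) (simp add: dir_deriv_eq[OF d])
  then show ?thesis using Suc d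
    by (auto simp: Ck_on_const differentiable_on_def intro: differentiableI)
qed (auto intro!: continuous_intros)

lemma Ck_on_add:
  "Ck_on k g UNIV \<Longrightarrow> Ck_on k h UNIV \<Longrightarrow> Ck_on k (\<lambda>x. g x + h x) UNIV"
proof (induction k arbitrary: g h)
  case 0
  then show ?case by (auto intro!: continuous_intros)
next
  case (Suc k)
  then have dg: "g differentiable (at x)" and dh: "h differentiable (at x)" for x
    by (auto simp: differentiable_on_def)
  have "dir_deriv v (\<lambda>x. g x + h x) = (\<lambda>x. dir_deriv v g x + dir_deriv v h x)" for v
    by (rule ext, rule dir_deriv_eq, rule has_derivative_add)
       (use dg dh has_derivative_dir_deriv in blast)+
  then show ?case using Suc by (auto simp: differentiable_on_add)
qed

lemma Ck_on_mult:
  "Ck_on k g UNIV \<Longrightarrow> Ck_on k h UNIV \<Longrightarrow> Ck_on k (\<lambda>x. g x * h x) UNIV"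
proof (induction k arbitrary: g h)
  case 0
  then show ?case by (auto intro!: continuous_intros)
next
  case (Suc k)
  then have dg: "g differentiable (at x)" and dh: "h differentiable (at x)" for x
    by (auto simp: differentiable_on_def)
  have "dir_deriv v (\<lambda>x. g x * h x) = (\<lambda>x. g x * dir_deriv v h x + dir_deriv v g x * h x)" for v
    by (rule ext, rule dir_deriv_eq, rule has_derivative_mult)
       (use dg dh has_derivative_dir_deriv in blast)+
  moreover have "Ck_on k g UNIV" "Ck_on k h UNIV"
    using Suc.prems Ck_on_Suc_imp by blast+
  ultimately show ?case using Suc by (auto intro!: Ck_on_add simp: differentiable_on_mult)
qed

text \<open>
The powers of $s$ in the denominator make the family closed under differentiation up to linear
combinations, which is what allows an induction on the order of smoothness for all exponents at
once.
\<close>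

definition flat_exp :: "nat \<Rightarrow> real \<Rightarrow> real" where
  "flat_exp m s = (if s > 0 then exp (- (1 / s)) / s ^ m else 0)"

lemma flat_exp_nonneg: "flat_exp m s \<ge> 0"
  by (simp add: flat_exp_def)

lemma flat_exp_tendsto_0: "(flat_exp m \<longlongrightarrow> 0) (at 0)"
proof -
  have "((\<lambda>s::real. inverse s ^ m / exp (inverse s)) \<longlongrightarrow> 0) (at_right 0)"
    by (rule filterlim_compose[OF tendsto_power_div_exp_0 filterlim_inverse_at_top_right])
  moreover have "\<forall>\<^sub>F s in at_right (0::real). inverse s ^ m / exp (inverse s) = flat_exp m s"
    by (rule eventually_at_rightI[of 0 1]) (auto simp: flat_exp_def exp_minus field_simps)
  ultimately have "(flat_exp m \<longlongrightarrow> 0) (at_right 0)"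
    by (rule Lim_transform_eventually)
  moreover have "(flat_exp m \<longlongrightarrow> 0) (at_left 0)"
    by (rule Lim_transform_eventually[OF tendsto_const])
       (auto intro!: eventually_at_leftI[of "-1"] simp: flat_exp_def)
  ultimately show ?thesis by (simp add: filterlim_at_split)
qed

text \<open>
Away from 0 this is calculus. At 0 the difference quotient of \<open>flat_exp m\<close> is \<open>flat_exp (m + 1)\<close>
itself, so differentiability there is again the flatness of the family.
\<close>

lemma flat_exp_has_derivative:
  "(flat_exp m has_real_derivative flat_exp (m + 2) s - real m * flat_exp (m + 1) s) (at s)"
proof -
  consider "s < 0" | "s = 0" | "s > 0" by linarith
  then show ?thesis
  proof cases
    case 1
    have "((\<lambda>_. 0) has_real_derivative 0) (at s)" by simp
    then have "(flat_exp m has_real_derivative 0) (at s)"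
      by (rule has_field_derivative_transform_within_open[where S="{..<0}"])
         (use 1 in \<open>auto simp: flat_exp_def\<close>)
    then show ?thesis using 1 by (simp add: flat_exp_def)
  next
    case 2
    have "((\<lambda>h. (flat_exp m (0 + h) - flat_exp m 0) / h) \<longlongrightarrow> 0) (at 0)"
      by (rule Lim_transform_eventually[OF flat_exp_tendsto_0[of "Suc m"]])
         (auto simp: flat_exp_def eventually_at_filter intro!: always_eventually)
    then have "(flat_exp m has_real_derivative 0) (at 0)" by (simp only: DERIV_def)
    then show ?thesis using 2 by (simp add: flat_exp_def)
  next
    case 3
    have "((\<lambda>s. exp (- (1 / s)) * inverse s ^ m) has_real_derivative
      flat_exp (m + 2) s - real m * flat_exp (m + 1) s) (at s)"
      using 3 by (auto intro!: derivative_eq_intros simp: flat_exp_def field_simps power2_eq_square)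
         (cases m; auto simp: field_simps power2_eq_square)
    then show ?thesis
      by (rule has_field_derivative_transform_within_open[where S="{0<..}"])
         (use 3 in \<open>auto simp: flat_exp_def field_simps\<close>)
  qed
qed

lemma Ck_on_flat_exp_sphere:
  fixes c :: real
  shows "Ck_on k (\<lambda>x::'a::euclidean_space. flat_exp m (c - x \<bullet> x)) UNIV"
proof (induction k arbitrary: m)
  case 0
  have "continuous_on UNIV (flat_exp m)"
    using flat_exp_has_derivative DERIV_isCont continuous_at_imp_continuous_on by blast
  then show ?case
    by (auto intro!: continuous_intros continuous_on_compose2[where g="flat_exp m" and t=UNIV])
next
  case (Suc k)
  let ?D = "\<lambda>x::'a. flat_exp (m + 2) (c - x \<bullet> x) + (- real m) * flat_exp (m + 1) (c - x \<bullet> x)"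
  have d: "((\<lambda>x::'a. flat_exp m (c - x \<bullet> x)) has_derivative (\<lambda>v. (- 2 * (x \<bullet> v)) * ?D x)) (at x)" for x
  proof -
    have 1: "((\<lambda>x::'a. c - x \<bullet> x) has_derivative (\<lambda>v. - 2 * (x \<bullet> v))) (at x)"
      by (auto intro!: derivative_eq_intros simp: inner_commute)
    have 2: "(flat_exp m has_derivative (*) (?D x)) (at (c - x \<bullet> x))"
      using flat_exp_has_derivative[of m "c - x \<bullet> x"] by (simp add: has_field_derivative_def)
    show ?thesis
      using has_derivative_compose[OF 1 2] by (simp add: mult.commute)
  qed
  have "dir_deriv v (\<lambda>x::'a. flat_exp m (c - x \<bullet> x)) = (\<lambda>x. (- 2 * (x \<bullet> v)) * ?D x)" for v
    by (rule ext) (rule dir_deriv_eq[OF d])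
  moreover have "Ck_on k (\<lambda>x. (- 2 * (x \<bullet> v)) * ?D x) UNIV" for v :: 'a
    by (intro Ck_on_mult Ck_on_add Ck_on_const Ck_on_inner Suc)
  ultimately show ?case
    using d by (auto simp: differentiable_on_def intro: differentiableI)
qed

text \<open>
Both directions are needed as an equivalence of the two derivative predicates: it makes the
identities below hold without assuming differentiability, because the two choices made by
\<open>frechet_derivative\<close> then coincide.
\<close>

lemma has_derivative_shift_iff:
  fixes g :: "'a::real_normed_vector \<Rightarrow> 'b::real_normed_vector"
  shows "((\<lambda>x. g (x - a)) has_derivative D) (at x) \<longleftrightarrow> (g has_derivative D) (at (x - a))"
proof
  assume "((\<lambda>x. g (x - a)) has_derivative D) (at x)"
  moreover have "((\<lambda>y. y + a) has_derivative (\<lambda>v. v)) (at (x - a))"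
    by (auto intro!: derivative_eq_intros)
  ultimately show "(g has_derivative D) (at (x - a))"
    using has_derivative_compose[of "\<lambda>y. y + a" "\<lambda>v. v" "x - a" UNIV "\<lambda>x. g (x - a)" D] by simp
next
  assume "(g has_derivative D) (at (x - a))"
  moreover have "((\<lambda>y. y - a) has_derivative (\<lambda>v. v)) (at x)"
    by (auto intro!: derivative_eq_intros)
  ultimately show "((\<lambda>x. g (x - a)) has_derivative D) (at x)"
    using has_derivative_compose[of "\<lambda>y. y - a" "\<lambda>v. v" x UNIV g D] by simp
qed

lemma dir_deriv_shift: "dir_deriv v (\<lambda>x. g (x - a)) = (\<lambda>x. dir_deriv v g (x - a))"
  by (rule ext) (simp add: dir_deriv_def frechet_derivative_def has_derivative_shift_iff)

lemma laplacian_shift: "laplacian (\<lambda>x. g (x - a)) x = laplacian g (x - a)"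
  by (simp add: laplacian_def dir_deriv_shift)

lemma Ck_on_shift: "Ck_on k g UNIV \<Longrightarrow> Ck_on k (\<lambda>x. g (x - a)) UNIV"
proof (induction k arbitrary: g)
  case 0
  then show ?case
    by (auto intro!: continuous_intros continuous_on_compose2[where g=g and t=UNIV])
next
  case (Suc k)
  then show ?case
    by (auto simp: dir_deriv_shift differentiable_on_def differentiable_def has_derivative_shift_iff)
qed

lemma closure_support_shift:
  fixes \<phi> :: "'a::euclidean_space \<Rightarrow> real"
  shows "closure {x. \<phi> (x - a) \<noteq> 0} = (\<lambda>x. a + x) ` closure {x. \<phi> x \<noteq> 0}"
proof -
  have "{x. \<phi> (x - a) \<noteq> 0} = (\<lambda>x. a + x) ` {x. \<phi> x \<noteq> 0}"
    by (auto simp: image_iff intro!: exI[of _ "_ - a"])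
  then show ?thesis by (simp add: closure_translation)
qed

lemma test_function_shift:
  assumes "test_function V \<phi>" and "(\<lambda>x. a + x) ` V \<subseteq> W"
  shows "test_function W (\<lambda>x. \<phi> (x - a))"
  using assms compact_translation[of "closure {x. \<phi> x \<noteq> 0}" a]
  unfolding test_function_def closure_support_shift by (auto simp: Ck_on_shift)

text \<open>
A function of $|x|^2$ because the norm itself is not differentiable at the origin.
\<close>

definition bump :: "real \<Rightarrow> 'a::euclidean_space \<Rightarrow> real" where
  "bump \<delta> x = flat_exp 0 (\<delta>\<^sup>2 - x \<bullet> x)"

lemma bump_nonneg: "bump \<delta> x \<ge> 0"
  by (simp add: bump_def flat_exp_nonneg)

lemma bump_pos_iff: "\<delta> > 0 \<Longrightarrow> bump \<delta> x > 0 \<longleftrightarrow> norm x < \<delta>"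
  using power2_less_imp_less[of "norm x" \<delta>] power_strict_mono[of "norm x" \<delta> 2]
  by (auto simp: bump_def flat_exp_def power2_norm_eq_inner[symmetric])

lemma bump_support:
  assumes "\<delta> > 0"
  shows "closure {x::'a::euclidean_space. bump \<delta> x \<noteq> 0} \<subseteq> cball 0 \<delta>"
proof -
  have "{x::'a. bump \<delta> x \<noteq> 0} \<subseteq> cball 0 \<delta>"
    using assms bump_pos_iff[of \<delta>] bump_nonneg[of \<delta>] by (force simp: less_le)
  then show ?thesis by (rule closure_minimal) simp
qed

lemma test_function_bump:
  assumes "\<delta> > 0" "cball 0 \<delta> \<subseteq> V"
  shows "test_function V (bump \<delta>)"
proof -
  have "Ck_on k (bump \<delta>) (UNIV::'a set)" for k
    unfolding bump_def[abs_def] by (rule Ck_on_flat_exp_sphere)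
  moreover have "compact (closure {x::'a. bump \<delta> x \<noteq> 0})"
    using compact_Int_closed[OF compact_cball closed_closure] bump_support[OF assms(1)]
    by (metis inf.absorb2)
  ultimately show ?thesis
    using bump_support[OF assms(1)] assms(2) by (auto simp: test_function_def)
qed

section \<open>Weak solutions\<close>

lemma test_function_D:
  assumes "test_function V \<phi>"
  defines "S \<equiv> closure {x. \<phi> x \<noteq> 0}"
  shows "compact S" "S \<subseteq> V" "continuous_on UNIV \<phi>" "Ck_on 2 \<phi> UNIV"
    "\<And>x. x \<notin> S \<Longrightarrow> \<phi> x = 0"
proof -
  have "Ck_on 0 \<phi> UNIV" using assms(1) unfolding test_function_def by blast
  then show "continuous_on UNIV \<phi>" by simp
qed (use assms(1) closure_subset[of "{x. \<phi> x \<noteq> 0}"]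
  in \<open>auto simp: S_def test_function_def\<close>)

lemma dir_deriv_outside_support:
  assumes "closed S" "\<And>x. x \<notin> S \<Longrightarrow> g x = 0" "x \<notin> S"
  shows "dir_deriv v g x = 0"
proof -
  have "((\<lambda>x. 0) has_derivative (\<lambda>v. 0)) (at x)" by simp
  then have "(g has_derivative (\<lambda>v. 0)) (at x)"
    by (rule has_derivative_transform_within_open[where s="- S"]) (use assms in auto)
  then show ?thesis by (rule dir_deriv_eq)
qed

lemma test_function_second_derivative:
  assumes "test_function V \<phi>" "e \<in> Basis"
  defines "S \<equiv> closure {x. \<phi> x \<noteq> 0}"
  shows "continuous_on UNIV (dir_deriv e (dir_deriv e \<phi>))"
    "\<And>x. x \<notin> S \<Longrightarrow> dir_deriv e (dir_deriv e \<phi>) x = 0"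
proof -
  show "continuous_on UNIV (dir_deriv e (dir_deriv e \<phi>))"
    using test_function_D(4)[OF assms(1)] assms(2) by (simp add: numeral_2_eq_2)
  have S: "closed S" "\<And>x. x \<notin> S \<Longrightarrow> \<phi> x = 0"
    using test_function_D(5)[OF assms(1)] unfolding S_def by blast+
  have "dir_deriv e \<phi> x = 0" if "x \<notin> S" for x
    by (rule dir_deriv_outside_support[OF S that])
  then show "dir_deriv e (dir_deriv e \<phi>) x = 0" if "x \<notin> S" for x
    by (rule dir_deriv_outside_support[OF S(1) _ that])
qed

lemma test_function_laplacian:
  assumes "test_function V \<phi>"
  defines "S \<equiv> closure {x. \<phi> x \<noteq> 0}"
  shows "continuous_on UNIV (laplacian \<phi>)" "\<And>x. x \<notin> S \<Longrightarrow> laplacian \<phi> x = 0"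
  using test_function_second_derivative[OF assms(1)]
  unfolding S_def laplacian_def[abs_def] by (auto intro!: continuous_intros)

lemma test_function_vanishes_outside:
  assumes "test_function V \<phi>" "x \<notin> V"
  shows "\<phi> x = 0" "laplacian \<phi> x = 0"
  using test_function_D(2,5)[OF assms(1)] test_function_laplacian(2)[OF assms(1)] assms(2)
  by (meson subsetD)+

lemma bounded_if_continuous_compact_support:
  fixes h :: "'a::topological_space \<Rightarrow> real"
  assumes "compact S" "continuous_on UNIV h" "\<And>x. x \<notin> S \<Longrightarrow> h x = 0"
  obtains B where "B \<ge> 0" "\<And>x. \<bar>h x\<bar> \<le> B"
proof -
  have "bounded (h ` S)"
    using assms by (meson compact_continuous_image compact_imp_bounded continuous_on_subset subset_UNIV)
  then obtain B where "B > 0" "\<And>x. x \<in> S \<Longrightarrow> \<bar>h x\<bar> \<le> B"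
    by (auto simp: bounded_pos)
  then show thesis using that[of B] assms(3) by (metis abs_zero less_imp_le)
qed

lemma integrable_compact_support:
  fixes u h :: "'a::euclidean_space \<Rightarrow> real"
  assumes "compact S" "continuous_on S u" "continuous_on UNIV h" "\<And>x. x \<notin> S \<Longrightarrow> h x = 0"
  shows "integrable lborel (\<lambda>x. u x * h x)"
proof -
  have "continuous_on S (\<lambda>x. u x * h x)"
    using assms(2) continuous_on_subset[OF assms(3)] by (auto intro!: continuous_intros)
  from borel_integrable_compact[OF assms(1) this]
  have "integrable lborel (\<lambda>x. indicator S x *\<^sub>R (u x * h x))" .
  moreover have "(\<lambda>x. indicator S x *\<^sub>R (u x * h x)) = (\<lambda>x. u x * h x)"
    by (rule ext) (use assms(4) in \<open>auto simp: indicator_def\<close>)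
  ultimately show ?thesis by (simp only:)
qed

text \<open>
Test functions and their Laplacians vanish outside \<open>V\<close>, so the integrals may be taken over the
whole space. In this form \<open>V\<close> only restricts the test functions, and the behaviour under
restriction, translation and change of sign becomes transparent.
\<close>

lemma weak_solution_iff:
  "weak_solution f V u \<longleftrightarrow> (\<forall>\<phi>. test_function V \<phi> \<longrightarrow>
     (LINT x|lborel. u x * laplacian \<phi> x) = (LINT x|lborel. f (u x) * \<phi> x))"
proof -
  have vanish: "(LINT x:V|lborel. h x * g x) = (LINT x|lborel. h x * g x)"
    if "\<And>x. x \<notin> V \<Longrightarrow> g x = 0" for h g :: "'a \<Rightarrow> real"
    unfolding set_lebesgue_integral_def
    by (rule Bochner_Integration.integral_cong) (use that in \<open>auto simp: indicator_def\<close>)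
  have "(LINT x:V|lborel. h x * laplacian \<phi> x) = (LINT x|lborel. h x * laplacian \<phi> x)"
    "(LINT x:V|lborel. h x * \<phi> x) = (LINT x|lborel. h x * \<phi> x)"
    if "test_function V \<phi>" for \<phi> h
    using test_function_vanishes_outside[OF that] by (auto intro: vanish)
  then show ?thesis by (auto simp: weak_solution_def)
qed

lemma weak_solution_subset: "weak_solution f V u \<Longrightarrow> W \<subseteq> V \<Longrightarrow> weak_solution f W u"
  unfolding weak_solution_iff test_function_def by blast

lemma weak_solution_cong:
  assumes "weak_solution f V u" "\<And>x. x \<in> V \<Longrightarrow> v x = u x"
  shows "weak_solution f V v"
proof -
  have "v x * laplacian \<phi> x = u x * laplacian \<phi> x" "f (v x) * \<phi> x = f (u x) * \<phi> x"
    if "test_function V \<phi>" for \<phi> x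
    using assms(2) test_function_vanishes_outside[OF that] by (cases "x \<in> V"; simp)+
  then show ?thesis using assms(1) unfolding weak_solution_iff by presburger
qed

text \<open>
The nonlinearity $-f(-s)$ satisfies the same growth condition as $f$; this turns upper bounds into
lower bounds.
\<close>

lemma weak_solution_uminus:
  "weak_solution f V u \<Longrightarrow> weak_solution (\<lambda>s. - f (- s)) V (\<lambda>x. - u x)"
  unfolding weak_solution_iff by simp

lemma lborel_integral_shift:
  fixes h :: "'a::euclidean_space \<Rightarrow> real"
  assumes "h \<in> borel_measurable borel"
  shows "(LINT y|lborel. h (y - a)) = (LINT y|lborel. h y)"
proof -
  have "(LINT y|lborel. h y) = (LINT y|distr lborel borel ((+) (- a)). h y)"
    by (simp add: lborel_distr_plus)
  also have "\<dots> = (LINT y|lborel. h (- a + y))"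
    by (rule integral_distr) (use assms in auto)
  finally show ?thesis by simp
qed

lemma weak_solution_shift:
  assumes u: "continuous_on V u" "weak_solution f V u" and f: "continuous_on UNIV f"
  shows "weak_solution f {x. x - a \<in> V} (\<lambda>x. u (x - a))"
  unfolding weak_solution_iff
proof (intro allI impI)
  fix \<phi> assume \<phi>: "test_function {x. x - a \<in> V} \<phi>"
  define \<psi> where "\<psi> = (\<lambda>x. \<phi> (x - (- a)))"
  have \<psi>: "test_function V \<psi>"
    unfolding \<psi>_def by (rule test_function_shift[OF \<phi>]) auto
  note S = test_function_D[OF \<psi>] test_function_laplacian[OF \<psi>]
  have cu: "continuous_on (closure {x. \<psi> x \<noteq> 0}) u"
    using u(1) S(2) continuous_on_subset by blast
  then have cfu: "continuous_on (closure {x. \<psi> x \<noteq> 0}) (\<lambda>x. f (u x))"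
    using continuous_on_compose2[OF f] by blast
  have "integrable lborel (\<lambda>x. u x * laplacian \<psi> x)"
    by (rule integrable_compact_support[OF S(1) cu S(6,7)])
  moreover have "integrable lborel (\<lambda>x. f (u x) * \<psi> x)"
    by (rule integrable_compact_support[OF S(1) cfu S(3,5)])
  ultimately have "(\<lambda>x. u x * laplacian \<psi> x) \<in> borel_measurable borel"
    "(\<lambda>x. f (u x) * \<psi> x) \<in> borel_measurable borel"
    using borel_measurable_integrable by fastforce+
  from this[THEN lborel_integral_shift, of a]
  have "(LINT y|lborel. u (y - a) * laplacian \<psi> (y - a)) = (LINT y|lborel. u y * laplacian \<psi> y)"
    "(LINT y|lborel. f (u (y - a)) * \<psi> (y - a)) = (LINT y|lborel. f (u y) * \<psi> y)" .
  moreover have "laplacian \<psi> (y - a) = laplacian \<phi> y" "\<psi> (y - a) = \<phi> y" for y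
    unfolding \<psi>_def laplacian_shift by simp_all
  ultimately show "(LINT x|lborel. u (x - a) * laplacian \<phi> x) = (LINT x|lborel. f (u (x - a)) * \<phi> x)"
    using u(2) \<psi> by (simp add: weak_solution_iff)
qed

section \<open>Pointwise Laplacians and mollification\<close>

definition discrete_laplacian :: "real \<Rightarrow> ('a::euclidean_space \<Rightarrow> real) \<Rightarrow> 'a \<Rightarrow> real" where
  "discrete_laplacian t w x =
     (\<Sum>i\<in>Basis. w (x + t *\<^sub>R i) + w (x - t *\<^sub>R i) - 2 * w x) / t\<^sup>2"

text \<open>
For twice continuously differentiable functions this is the usual Laplacian, but it makes sense for
functions that are only continuous and is exactly what a comparison at an interior maximum uses.
\<close>

definition has_laplacian :: "('a::euclidean_space \<Rightarrow> real) \<Rightarrow> 'a \<Rightarrow> real \<Rightarrow> bool" where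
  "has_laplacian w x L \<longleftrightarrow> ((\<lambda>t. discrete_laplacian t w x) \<longlongrightarrow> L) (at 0)"

lemma has_laplacian_diff:
  assumes "has_laplacian w x L" "has_laplacian v x M"
  shows "has_laplacian (\<lambda>x. w x - v x) x (L - M)"
proof -
  have "discrete_laplacian t (\<lambda>x. w x - v x) x
      = discrete_laplacian t w x - discrete_laplacian t v x" for t
    by (simp add: discrete_laplacian_def diff_divide_distrib[symmetric] sum_subtractf[symmetric])
       (simp add: algebra_simps)
  then show ?thesis
    using tendsto_diff[OF assms[unfolded has_laplacian_def]] by (simp add: has_laplacian_def)
qed

lemma has_laplacian_shift: "has_laplacian g (x - a) L \<Longrightarrow> has_laplacian (\<lambda>x. g (x - a)) x L"
  by (simp add: has_laplacian_def discrete_laplacian_def algebra_simps)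

lemma has_laplacian_at_max:
  assumes "has_laplacian w x L" "\<delta> > 0" "\<And>y. y \<in> ball x \<delta> \<Longrightarrow> w y \<le> w x"
  shows "L \<le> 0"
proof (rule tendsto_upperbound[OF assms(1)[unfolded has_laplacian_def]])
  show "\<forall>\<^sub>F t in at 0. discrete_laplacian t w x \<le> 0"
    unfolding eventually_at
  proof (intro exI conjI ballI impI)
    fix t :: real assume "t \<noteq> 0 \<and> dist t 0 < \<delta>"
    then have "w (x + t *\<^sub>R i) \<le> w x" "w (x - t *\<^sub>R i) \<le> w x" if "i \<in> Basis" for i
      using that by (auto intro!: assms(3) simp: dist_norm)
    then have "w (x + t *\<^sub>R i) + w (x - t *\<^sub>R i) - 2 * w x \<le> 0" if "i \<in> Basis" for i
      using that by (smt (verit))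
    then show "discrete_laplacian t w x \<le> 0"
      unfolding discrete_laplacian_def by (intro divide_nonpos_nonneg sum_nonpos) auto
  qed (use assms(2) in auto)
qed simp

lemma has_laplacian_sum_lines:
  assumes "\<And>i. i \<in> Basis \<Longrightarrow>
    ((\<lambda>t. (g (x + t *\<^sub>R i) + g (x - t *\<^sub>R i) - 2 * g x) / t\<^sup>2) \<longlongrightarrow> l i) (at 0)"
  shows "has_laplacian g x (\<Sum>i\<in>Basis. l i)"
  unfolding has_laplacian_def discrete_laplacian_def sum_divide_distrib
  by (intro tendsto_sum assms)

text \<open>
Taylor's formula in both directions: the first-order terms cancel. The explicit remainder
serves twice, for the limit of the second difference quotients and for a bound on them that is
uniform in the step size.
\<close>

lemma symmetric_second_difference:
  fixes p p' p'' :: "real \<Rightarrow> real"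
  assumes "\<And>s. \<bar>s\<bar> \<le> \<bar>t\<bar> \<Longrightarrow> (p has_real_derivative p' s) (at s)"
    and "\<And>s. \<bar>s\<bar> \<le> \<bar>t\<bar> \<Longrightarrow> (p' has_real_derivative p'' s) (at s)"
  obtains a b where "\<bar>a\<bar> \<le> \<bar>t\<bar>" "\<bar>b\<bar> \<le> \<bar>t\<bar>"
    "p t + p (- t) - 2 * p 0 = t\<^sup>2 * ((p'' a + p'' b) / 2)"
proof -
  define D where "D = (\<lambda>m::nat. if m = 0 then p else if m = 1 then p' else p'')"
  have taylor: "\<exists>a. \<bar>a\<bar> \<le> \<bar>s\<bar> \<and> p s = (\<Sum>m<2. D m 0 / fact m * s ^ m) + D 2 a / fact 2 * s ^ 2"
    if "\<bar>s\<bar> = \<bar>t\<bar>" for s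
    by (rule Maclaurin_bi_le) (use assms that in \<open>auto simp: D_def less_2_cases_iff\<close>)
  from taylor[of t] taylor[of "- t"] obtain a b where
    "\<bar>a\<bar> \<le> \<bar>t\<bar>" "p t = p 0 + p' 0 * t + p'' a / 2 * t\<^sup>2"
    "\<bar>b\<bar> \<le> \<bar>t\<bar>" "p (- t) = p 0 - p' 0 * t + p'' b / 2 * t\<^sup>2"
    by (auto simp: D_def numeral_2_eq_2)
  then show thesis by (intro that[of a b]) (auto simp: algebra_simps)
qed

lemma symmetric_second_difference_tendsto:
  fixes p p' p'' :: "real \<Rightarrow> real"
  assumes "r > 0" and p: "\<And>s. \<bar>s\<bar> \<le> r \<Longrightarrow> (p has_real_derivative p' s) (at s)"
    and p': "\<And>s. \<bar>s\<bar> \<le> r \<Longrightarrow> (p' has_real_derivative p'' s) (at s)"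
    and "isCont p'' 0"
  shows "((\<lambda>t. (p t + p (- t) - 2 * p 0) / t\<^sup>2) \<longlongrightarrow> p'' 0) (at 0)"
proof (rule tendstoI)
  fix e :: real assume "e > 0"
  then obtain d where d: "d > 0" "\<And>s. \<bar>s\<bar> < d \<Longrightarrow> \<bar>p'' s - p'' 0\<bar> < e"
    using assms(4) unfolding continuous_at_eps_delta by (auto simp: dist_real_def)
  show "\<forall>\<^sub>F t in at 0. dist ((p t + p (- t) - 2 * p 0) / t\<^sup>2) (p'' 0) < e"
    unfolding eventually_at
  proof (intro exI conjI ballI impI)
    fix t :: real assume t: "t \<noteq> 0 \<and> dist t 0 < min d r"
    obtain a b where ab: "\<bar>a\<bar> \<le> \<bar>t\<bar>" "\<bar>b\<bar> \<le> \<bar>t\<bar>"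
      "p t + p (- t) - 2 * p 0 = t\<^sup>2 * ((p'' a + p'' b) / 2)"
      by (rule symmetric_second_difference[of t p p' p'']) (use p p' t in auto)
    then have "(p t + p (- t) - 2 * p 0) / t\<^sup>2 = (p'' a + p'' b) / 2"
      using t by simp
    moreover have "\<bar>p'' a - p'' 0\<bar> < e" "\<bar>p'' b - p'' 0\<bar> < e"
      using ab(1,2) t by (auto intro!: d(2))
    then have "\<bar>(p'' a + p'' b) / 2 - p'' 0\<bar> < e" by argo
    ultimately show "dist ((p t + p (- t) - 2 * p 0) / t\<^sup>2) (p'' 0) < e"
      unfolding dist_real_def by (simp only:)
  qed (use d assms in auto)
qed

lemma Ck2_line_derivatives:
  assumes "Ck_on 2 \<phi> UNIV" "e \<in> Basis"
  shows "((\<lambda>t. \<phi> (x + t *\<^sub>R e)) has_real_derivative dir_deriv e \<phi> (x + t *\<^sub>R e)) (at t)"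
    "((\<lambda>t. dir_deriv e \<phi> (x + t *\<^sub>R e)) has_real_derivative
       dir_deriv e (dir_deriv e \<phi>) (x + t *\<^sub>R e)) (at t)"
proof -
  have line: "((\<lambda>t. g (x + t *\<^sub>R e)) has_real_derivative dir_deriv e g (x + t *\<^sub>R e)) (at t)"
    if "g differentiable (at (x + t *\<^sub>R e))" for g
  proof -
    have D: "(g has_derivative (\<lambda>v. dir_deriv v g (x + t *\<^sub>R e))) (at (x + t *\<^sub>R e))"
      by (rule has_derivative_dir_deriv[OF that])
    have "((\<lambda>t. x + t *\<^sub>R e) has_derivative (\<lambda>s. s *\<^sub>R e)) (at t)"
      by (auto intro!: derivative_eq_intros)
    from has_derivative_compose[OF this D]
    have "((\<lambda>t. g (x + t *\<^sub>R e)) has_derivative (\<lambda>s. dir_deriv (s *\<^sub>R e) g (x + t *\<^sub>R e))) (at t)" .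
    moreover have "dir_deriv (s *\<^sub>R e) g (x + t *\<^sub>R e) = dir_deriv e g (x + t *\<^sub>R e) * s" for s
      using linear_cmul[OF has_derivative_linear[OF D], of s e] by simp
    ultimately show ?thesis by (simp add: has_field_derivative_def)
  qed
  show "((\<lambda>t. \<phi> (x + t *\<^sub>R e)) has_real_derivative dir_deriv e \<phi> (x + t *\<^sub>R e)) (at t)"
    "((\<lambda>t. dir_deriv e \<phi> (x + t *\<^sub>R e)) has_real_derivative
       dir_deriv e (dir_deriv e \<phi>) (x + t *\<^sub>R e)) (at t)"
    using assms by (auto intro!: line simp: numeral_2_eq_2 differentiable_on_def)
qed

lemma has_laplacian_test_function:
  assumes "test_function V \<phi>"
  shows "has_laplacian \<phi> x (laplacian \<phi> x)"
proof -
  note C2 = test_function_D(4)[OF assms]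
  have "((\<lambda>t. (\<phi> (x + t *\<^sub>R e) + \<phi> (x - t *\<^sub>R e) - 2 * \<phi> x) / t\<^sup>2)
      \<longlongrightarrow> dir_deriv e (dir_deriv e \<phi>) x) (at 0)" if e: "e \<in> Basis" for e
  proof -
    have "isCont (\<lambda>t. dir_deriv e (dir_deriv e \<phi>) (x + t *\<^sub>R e)) 0"
    proof (rule continuous_on_interior)
      show "continuous_on UNIV (\<lambda>t. dir_deriv e (dir_deriv e \<phi>) (x + t *\<^sub>R e))"
        by (rule continuous_on_compose2[OF test_function_second_derivative(1)[OF assms e]])
           (auto intro!: continuous_intros)
    qed simp
    from symmetric_second_difference_tendsto[OF zero_less_one
        Ck2_line_derivatives(1)[OF C2 e] Ck2_line_derivatives(2)[OF C2 e] this]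
    show ?thesis by simp
  qed
  then show ?thesis
    unfolding has_laplacian_def discrete_laplacian_def laplacian_def sum_divide_distrib
    by (intro tendsto_sum)
qed

text \<open>
This is the domination that allows the limit of the second differences to be taken under an
integral.
\<close>

lemma discrete_laplacian_test_function_bounded:
  fixes \<phi> :: "'a::euclidean_space \<Rightarrow> real"
  assumes "test_function V \<phi>"
  obtains B where "B \<ge> 0" "\<And>t x. \<bar>discrete_laplacian t \<phi> x\<bar> \<le> B"
proof -
  note C2 = test_function_D(4)[OF assms]
  have "\<exists>B\<ge>0. \<forall>x. \<bar>dir_deriv e (dir_deriv e \<phi>) x\<bar> \<le> B" if e: "e \<in> Basis" for e
    using bounded_if_continuous_compact_support[OF test_function_D(1)[OF assms]
        test_function_second_derivative[OF assms e]] by metis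
  then obtain B where B: "\<And>e. e \<in> Basis \<Longrightarrow> B e \<ge> 0"
    "\<And>e x. e \<in> Basis \<Longrightarrow> \<bar>dir_deriv e (dir_deriv e \<phi>) x\<bar> \<le> B e" by metis
  have "\<bar>\<phi> (x + t *\<^sub>R e) + \<phi> (x - t *\<^sub>R e) - 2 * \<phi> x\<bar> \<le> t\<^sup>2 * B e" if e: "e \<in> Basis" for e t x
  proof -
    obtain a b where ab: "\<bar>a\<bar> \<le> \<bar>t\<bar>" "\<bar>b\<bar> \<le> \<bar>t\<bar>"
      "\<phi> (x + t *\<^sub>R e) + \<phi> (x + (- t) *\<^sub>R e) - 2 * \<phi> (x + 0 *\<^sub>R e)
      = t\<^sup>2 * ((dir_deriv e (dir_deriv e \<phi>) (x + a *\<^sub>R e) + dir_deriv e (dir_deriv e \<phi>) (x + b *\<^sub>R e)) / 2)"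
      by (rule symmetric_second_difference[OF Ck2_line_derivatives(1)[OF C2 e, of x]
          Ck2_line_derivatives(2)[OF C2 e, of x], of t])
    from ab(3) have "\<phi> (x + t *\<^sub>R e) + \<phi> (x - t *\<^sub>R e) - 2 * \<phi> x
      = t\<^sup>2 * ((dir_deriv e (dir_deriv e \<phi>) (x + a *\<^sub>R e) + dir_deriv e (dir_deriv e \<phi>) (x + b *\<^sub>R e)) / 2)"
      by (simp only: scaleR_minus_left scaleR_zero_left add_0_right add_uminus_conv_diff)
    moreover have "\<bar>(dir_deriv e (dir_deriv e \<phi>) (x + a *\<^sub>R e)
        + dir_deriv e (dir_deriv e \<phi>) (x + b *\<^sub>R e)) / 2\<bar> \<le> B e"
    proof -
      have "\<bar>p\<bar> \<le> r \<Longrightarrow> \<bar>q\<bar> \<le> r \<Longrightarrow> \<bar>(p + q) / 2\<bar> \<le> r" for p q r :: real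
        unfolding abs_le_iff by argo
      then show ?thesis using B(2)[OF e] by blast
    qed
    ultimately show ?thesis
      using mult_left_mono[OF _ zero_le_power2[of t]] by (simp only: abs_mult abs_power2)
  qed
  then have "\<bar>\<Sum>e\<in>Basis. \<phi> (x + t *\<^sub>R e) + \<phi> (x - t *\<^sub>R e) - 2 * \<phi> x\<bar> \<le> t\<^sup>2 * (\<Sum>e\<in>Basis. B e)" for t x
    unfolding sum_distrib_left by (intro order_trans[OF sum_abs] sum_mono)
  then have "\<bar>discrete_laplacian t \<phi> x\<bar> \<le> (\<Sum>e\<in>Basis. B e)" for t x
    using sum_nonneg[of Basis B] B(1)
    by (cases "t = 0") (auto simp: discrete_laplacian_def divide_simps mult.commute)
  then show thesis using that[of "\<Sum>e\<in>Basis. B e"] B(1) sum_nonneg by metis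
qed

lemma dominated_convergence_at:
  fixes G :: "'a::euclidean_space \<Rightarrow> real" and h :: "'b::{metric_space} \<Rightarrow> 'a \<Rightarrow> real"
  assumes G: "G \<in> borel_measurable borel" "compact K" "\<And>y. \<bar>G y\<bar> \<le> M * indicator K y"
    and h: "\<And>s. h s \<in> borel_measurable borel" "h0 \<in> borel_measurable borel"
      "\<And>s y. \<bar>h s y\<bar> \<le> B"
    and lim: "\<And>y. ((\<lambda>s. h s y) \<longlongrightarrow> h0 y) (at s0)"
  shows "((\<lambda>s. LINT y|lborel. G y * h s y) \<longlongrightarrow> (LINT y|lborel. G y * h0 y)) (at s0)"
  unfolding tendsto_at_iff_sequentially comp_def
proof (intro allI impI)
  fix X assume X: "\<forall>i::nat. X i \<in> UNIV - {s0}" "X \<longlonglongrightarrow> s0"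
  show "(\<lambda>i. LINT y|lborel. G y * h (X i) y) \<longlonglongrightarrow> (LINT y|lborel. G y * h0 y)"
  proof (rule integral_dominated_convergence)
    show "integrable lborel (\<lambda>y. M * B * indicator K y :: real)"
      using G(2) emeasure_compact_finite[OF G(2)] by (intro integrable_mult_right) (simp add: compact_imp_closed integrable_indicator_iff)
    show "AE y in lborel. (\<lambda>i. G y * h (X i) y) \<longlonglongrightarrow> G y * h0 y"
      using lim X unfolding tendsto_at_iff_sequentially comp_def
      by (intro AE_I2 tendsto_mult_left) blast
    show "AE y in lborel. norm (G y * h (X i) y) \<le> M * B * indicator K y" for i
    proof (rule AE_I2)
      fix y
      have "\<bar>G y\<bar> * \<bar>h (X i) y\<bar> \<le> (M * indicator K y) * B"
        using G(3)[of y] h(3) by (intro mult_mono) (auto intro: order_trans[OF abs_ge_zero])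
      then show "norm (G y * h (X i) y) \<le> M * B * indicator K y"
        by (simp add: abs_mult mult_ac)
    qed
  qed (use G(1) h(1,2) in auto)
qed


lemma integrable_bump_shift: "\<delta> > 0 \<Longrightarrow> integrable lborel (\<lambda>y::'a::euclidean_space. bump \<delta> (y - x))"
proof -
  assume "\<delta> > 0"
  then have T: "test_function UNIV (\<lambda>y::'a. bump \<delta> (y - x))"
    using test_function_shift[OF test_function_bump[of \<delta> UNIV]] by blast
  show ?thesis
    using integrable_compact_support[OF test_function_D(1)[OF T] continuous_on_const
        test_function_D(3,5)[OF T], of 1] by simp
qed

lemma integral_bump_pos:
  assumes "\<delta> > 0"
  shows "(LINT y|lborel. bump \<delta> (y::'a::euclidean_space)) > 0"
proof -
  define m where "m = exp (- (1 / (3 / 4 * \<delta>\<^sup>2)))"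
  let ?B = "cball 0 (\<delta> / 2) :: 'a set"
  have "m * indicator ?B y \<le> bump \<delta> y" for y :: 'a
  proof (cases "y \<in> ?B")
    case True
    then have "(norm y)\<^sup>2 \<le> (\<delta> / 2)\<^sup>2" by (intro power_mono) auto
    then have s: "3 / 4 * \<delta>\<^sup>2 \<le> \<delta>\<^sup>2 - y \<bullet> y"
      by (simp add: power2_norm_eq_inner[symmetric] power_divide)
    moreover have "3 / 4 * \<delta>\<^sup>2 > 0" using assms by simp
    ultimately have pos: "\<delta>\<^sup>2 - y \<bullet> y > 0" by linarith
    have "1 / (\<delta>\<^sup>2 - y \<bullet> y) \<le> 1 / (3 / 4 * \<delta>\<^sup>2)"
      by (rule divide_left_mono[OF s]) (use pos assms in simp_all)
    then have "m \<le> exp (- (1 / (\<delta>\<^sup>2 - y \<bullet> y)))"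
      unfolding m_def exp_le_cancel_iff neg_le_iff_le by blast
    with pos show ?thesis using True by (simp add: bump_def flat_exp_def)
  qed (simp add: bump_nonneg)
  then have "(LINT y|lborel. m * indicator ?B y) \<le> (LINT y|lborel. bump \<delta> (y::'a))"
    using integrable_bump_shift[OF assms, of 0]
    by (intro Bochner_Integration.integral_mono)
       (auto simp: integrable_indicator_iff emeasure_lborel_cball_finite[unfolded infinity_ennreal_def])
  moreover have "(LINT y|lborel. m * indicator ?B y) = m * measure lborel ?B" by simp
  moreover have "measure lborel ?B > 0" using assms by (intro content_cball_pos) simp
  ultimately show ?thesis by (smt (verit) exp_gt_zero m_def mult_pos_pos)
qed

text \<open>
Dividing by \<open>c\<close> normalizes the total mass, so a weighted mean of values that differ from \<open>H x\<close> by
at most \<open>\<eta>\<close> does so too. The normalization is by the integral because the family \<open>bump \<delta>\<close> is not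
a rescaling of a single function.
\<close>

lemma bump_average:
  fixes H :: "'a::euclidean_space \<Rightarrow> real"
  assumes "\<delta> > 0" "H \<in> borel_measurable borel" "\<And>y. \<bar>H y\<bar> \<le> B"
    and osc: "\<And>y. dist y x < \<delta> \<Longrightarrow> \<bar>H y - H x\<bar> \<le> \<eta>"
  defines "c \<equiv> LINT y|lborel. bump \<delta> (y::'a)"
  shows "\<bar>(LINT y|lborel. H y * bump \<delta> (y - x)) / c - H x\<bar> \<le> \<eta>"
proof -
  let ?b = "\<lambda>y. bump \<delta> (y - x)"
  note b = integrable_bump_shift[OF assms(1), of x]
  have c: "c > 0" unfolding c_def by (rule integral_bump_pos[OF assms(1)])
  have cx: "(LINT y|lborel. ?b y) = c"
    unfolding c_def using integrable_bump_shift[OF assms(1), of "0::'a"]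
    by (intro lborel_integral_shift) (auto dest: borel_measurable_integrable)
  have Hb: "integrable lborel (\<lambda>y. H y * ?b y)"
  proof (rule Bochner_Integration.integrable_bound)
    show "integrable lborel (\<lambda>y. B * ?b y)" using b by simp
    have "\<bar>H y * ?b y\<bar> \<le> \<bar>B * ?b y\<bar>" for y
      using assms(3)[of y] by (auto simp: abs_mult intro!: mult_right_mono)
    then show "AE y in lborel. norm (H y * ?b y) \<le> norm (B * ?b y)" by simp
  qed (use assms(2) borel_measurable_integrable[OF b] in auto)
  have "(LINT y|lborel. H y * ?b y) - H x * c = (LINT y|lborel. (H y - H x) * ?b y)"
    using Hb b cx by (simp add: left_diff_distrib)
  also have "\<bar>\<dots>\<bar> \<le> (LINT y|lborel. \<eta> * ?b y)"
  proof (rule integral_abs_bound_integral)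
    show "\<bar>(H y - H x) * ?b y\<bar> \<le> \<eta> * ?b y" for y
    proof (cases "dist y x < \<delta>")
      case True
      then show ?thesis
        using osc[of y] bump_nonneg[of \<delta> "y - x"] by (auto simp: abs_mult intro!: mult_right_mono)
    next
      case False
      then have "?b y = 0"
        using bump_pos_iff[OF assms(1), of "y - x"] bump_nonneg[of \<delta> "y - x"]
        by (auto simp: dist_norm)
      then show ?thesis by simp
    qed
  qed (use Hb b in \<open>auto simp: left_diff_distrib\<close>)
  finally have "\<bar>(LINT y|lborel. H y * ?b y) - H x * c\<bar> \<le> \<eta> * c"
    by (simp add: cx)
  then have "\<bar>((LINT y|lborel. H y * ?b y) - H x * c) / c\<bar> \<le> \<eta>"
    using c by (simp add: abs_divide divide_simps)
  then show ?thesis using c by (simp add: diff_divide_distrib)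
qed

lemma uniformly_close_near_compact:
  fixes g :: "'a::euclidean_space \<Rightarrow> real"
  assumes "compact K" "continuous_on K g" "\<eta> > 0"
  obtains \<delta> where "\<delta> > 0" "\<And>x y. x \<in> K \<Longrightarrow> y \<in> K \<Longrightarrow> dist y x < \<delta> \<Longrightarrow> \<bar>g y - g x\<bar> \<le> \<eta>"
proof -
  have "uniformly_continuous_on K g"
    by (rule compact_uniformly_continuous[OF assms(2,1)])
  then obtain \<delta> where "\<delta> > 0" "\<And>x y. x \<in> K \<Longrightarrow> y \<in> K \<Longrightarrow> dist y x < \<delta> \<Longrightarrow> dist (g y) (g x) < \<eta>"
    using \<open>\<eta> > 0\<close> unfolding uniformly_continuous_on_def by metis
  then show thesis using that[of \<delta>] by (fastforce simp: dist_real_def)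
qed

lemma compact_enlargement:
  fixes K :: "'a::euclidean_space set"
  assumes "compact K" "open V" "K \<subseteq> V"
  obtains \<delta> K' where "\<delta> > 0" "compact K'" "K' \<subseteq> V" "\<And>x. x \<in> K \<Longrightarrow> cball x \<delta> \<subseteq> K'"
proof -
  obtain e where e: "e > 0" "(\<Union>x\<in>K. cball x e) \<subseteq> V"
    using compact_subset_open_imp_cball_epsilon_subset[OF assms] .
  show thesis
  proof (rule that[of e "{x + z | x z. x \<in> K \<and> z \<in> cball 0 e}"])
    show "compact {x + z | x z. x \<in> K \<and> z \<in> cball 0 e}"
      by (rule compact_sums[OF assms(1) compact_cball])
    show "{x + z | x z. x \<in> K \<and> z \<in> cball 0 e} \<subseteq> V"
      using e(2) by (force simp: dist_norm)
    show "cball x e \<subseteq> {x + z | x z. x \<in> K \<and> z \<in> cball 0 e}" if "x \<in> K" for x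
    proof
      fix y assume "y \<in> cball x e"
      then have "y = x + (y - x)" "y - x \<in> cball 0 e" by (auto simp: dist_norm norm_minus_commute)
      then show "y \<in> {x + z | x z. x \<in> K \<and> z \<in> cball 0 e}" using that by blast
    qed
  qed (rule e)
qed

text \<open>
The mollified function is $w(x) = \frac1c \int u(y) \rho(y - x)\,dy$ with a bump $\rho$ of small
radius. Its second differences fall on $\rho$, so its Laplacian is
$\frac1c \int u(y) \Delta\rho(y - x)\,dy$; for $x \in K$ the function $\rho(\cdot - x)$ is a test
function in $V$, and the weak equation turns this into $\frac1c \int f(u(y)) \rho(y - x)\,dy$, an
average of $f(u)$ near $x$. Uniform continuity on a compact neighbourhood of $K$ bounds both errors.
\<close>

lemma weak_solution_approximation:
  fixes u :: "'a::euclidean_space \<Rightarrow> real"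
  assumes V: "open V" and u: "continuous_on V u" "weak_solution f V u"
    and f: "continuous_on UNIV f" and K: "compact K" "K \<subseteq> V" and \<eta>: "\<eta> > 0"
  obtains w where "continuous_on UNIV w" "\<And>x. x \<in> K \<Longrightarrow> \<bar>w x - u x\<bar> \<le> \<eta>"
    "\<And>x. x \<in> K \<Longrightarrow> \<exists>L. has_laplacian w x L \<and> \<bar>L - f (u x)\<bar> \<le> \<eta>"
proof -
  obtain \<delta>0 K' where K': "\<delta>0 > 0" "compact K'" "K' \<subseteq> V" "\<And>x. x \<in> K \<Longrightarrow> cball x \<delta>0 \<subseteq> K'"
    using compact_enlargement[OF K(1) V K(2)] by metis
  have cu: "continuous_on K' u" using u(1) K'(3) continuous_on_subset by blast
  have cfu: "continuous_on K' (\<lambda>x. f (u x))"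
    by (rule continuous_on_compose2[OF f cu]) simp
  obtain \<delta>1 where \<delta>1: "\<delta>1 > 0" "\<And>x y. x \<in> K' \<Longrightarrow> y \<in> K' \<Longrightarrow> dist y x < \<delta>1 \<Longrightarrow> \<bar>u y - u x\<bar> \<le> \<eta>"
    using uniformly_close_near_compact[OF K'(2) cu \<eta>] by metis
  obtain \<delta>2 where \<delta>2: "\<delta>2 > 0"
    "\<And>x y. x \<in> K' \<Longrightarrow> y \<in> K' \<Longrightarrow> dist y x < \<delta>2 \<Longrightarrow> \<bar>f (u y) - f (u x)\<bar> \<le> \<eta>"
    using uniformly_close_near_compact[OF K'(2) cfu \<eta>] by metis
  define \<delta> where "\<delta> = min \<delta>0 (min \<delta>1 \<delta>2)"
  have \<delta>: "\<delta> > 0" "\<delta> \<le> \<delta>0" "\<delta> \<le> \<delta>1" "\<delta> \<le> \<delta>2" using K'(1) \<delta>1(1) \<delta>2(1) by (auto simp: \<delta>_def)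
  have xK': "x \<in> K'" if "x \<in> K" for x using K'(4)[OF that] K'(1) by auto
  have near: "y \<in> K'" if "x \<in> K" "dist y x \<le> \<delta>" for x y
    using K'(4)[OF that(1)] that(2) \<delta>(2) by (auto simp: dist_commute)
  define c where "c = (LINT y|lborel. bump \<delta> (y::'a))"
  have c: "c > 0" unfolding c_def by (rule integral_bump_pos[OF \<delta>(1)])
  define cut :: "('a \<Rightarrow> real) \<Rightarrow> 'a \<Rightarrow> real" where "cut = (\<lambda>g y. indicator K' y *\<^sub>R g y)"
  have cut_eq: "cut g y = g y" if "y \<in> K'" for g y using that by (simp add: cut_def)
  have cut: "cut g \<in> borel_measurable borel" "\<exists>M. \<forall>y. \<bar>cut g y\<bar> \<le> M * indicator K' y"
    if g: "continuous_on K' g" for g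
  proof -
    show "cut g \<in> borel_measurable borel"
      unfolding cut_def
      by (rule borel_measurable_continuous_on_indicator[OF borel_compact[OF K'(2)] g])
    obtain M where "\<And>y. y \<in> K' \<Longrightarrow> \<bar>g y\<bar> \<le> M"
      using compact_imp_bounded[OF compact_continuous_image[OF g K'(2)]]
      by (auto simp: bounded_iff)
    then show "\<exists>M. \<forall>y. \<bar>cut g y\<bar> \<le> M * indicator K' y"
      by (intro exI[of _ M]) (auto simp: cut_def indicator_def)
  qed
  have average: "\<bar>(LINT y|lborel. cut g y * bump \<delta> (y - x)) / c - g x\<bar> \<le> \<eta>"
    if g: "continuous_on K' g" "\<And>y. y \<in> K' \<Longrightarrow> dist y x < \<delta> \<Longrightarrow> \<bar>g y - g x\<bar> \<le> \<eta>" and x: "x \<in> K" for g x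
  proof -
    obtain M where M: "\<And>y. \<bar>cut g y\<bar> \<le> M * indicator K' y" using cut(2)[OF g(1)] by metis
    have "\<bar>cut g y\<bar> \<le> \<bar>M\<bar>" for y
      using M[of y] abs_ge_self[of M] by (cases "y \<in> K'") (auto simp: cut_def)
    moreover have "\<bar>cut g y - cut g x\<bar> \<le> \<eta>" if "dist y x < \<delta>" for y
      using g(2)[of y] that near[OF x, of y] xK'[OF x] by (simp add: cut_eq)
    ultimately have "\<bar>(LINT y|lborel. cut g y * bump \<delta> (y - x)) / c - cut g x\<bar> \<le> \<eta>"
      unfolding c_def using bump_average[OF \<delta>(1) cut(1)[OF g(1)]] by blast
    then show ?thesis using xK'[OF x] by (simp add: cut_eq)
  qed
  define w where "w = (\<lambda>x. (LINT y|lborel. cut u y * bump \<delta> (y - x)) / c)"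
  have T: "test_function UNIV (bump \<delta> :: 'a \<Rightarrow> real)"
    by (rule test_function_bump[OF \<delta>(1)]) simp
  note bump_cont = test_function_D(3)[OF T]
  have bump_meas: "(\<lambda>y::'a. bump \<delta> (y - x)) \<in> borel_measurable borel" for x
    using borel_measurable_integrable[OF integrable_bump_shift[OF \<delta>(1), of x]] by simp
  obtain M where M: "\<And>y. \<bar>cut u y\<bar> \<le> M * indicator K' y" using cut(2)[OF cu] by metis
  show thesis
  proof (rule that[of w])
    obtain B where B: "\<And>y::'a. \<bar>bump \<delta> y\<bar> \<le> B"
      using bounded_if_continuous_compact_support[OF test_function_D(1,3,5)[OF T]] by metis
    have "(w \<longlongrightarrow> w x) (at x)" for x
      unfolding w_def
    proof (intro tendsto_divide dominated_convergence_at[OF cut(1)[OF cu] K'(2) M bump_meas bump_meas B] tendsto_const)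
      show "((\<lambda>s. bump \<delta> (y - s)) \<longlongrightarrow> bump \<delta> (y - x)) (at x)" for y
        using bump_cont
        by (intro isCont_tendsto_compose[of _ "bump \<delta>"] tendsto_intros)
           (simp add: continuous_on_eq_continuous_at)
    qed (use c in simp)
    then show "continuous_on UNIV w" by (simp add: continuous_on_def)
    show "\<bar>w x - u x\<bar> \<le> \<eta>" if "x \<in> K" for x
      unfolding w_def using \<delta>1(2) xK'[OF that] \<delta>(3) by (intro average[OF cu _ that]) auto
    show "\<exists>L. has_laplacian w x L \<and> \<bar>L - f (u x)\<bar> \<le> \<eta>" if x: "x \<in> K" for x
    proof (intro exI conjI)
      let ?\<phi> = "\<lambda>y. bump \<delta> (y - x)"
      have Tx: "test_function (cball x \<delta>) ?\<phi>"
        by (rule test_function_shift[OF test_function_bump[OF \<delta>(1) order_refl]])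
           (auto simp: dist_norm)
      have sub: "cball x \<delta> \<subseteq> K'" using near[OF x] by (auto simp: dist_commute)
      obtain D where D: "\<And>t y. \<bar>discrete_laplacian t (bump \<delta>) (y::'a)\<bar> \<le> D"
        using discrete_laplacian_test_function_bounded[OF T] by metis
      have dl: "discrete_laplacian t w x
          = (LINT y|lborel. cut u y * discrete_laplacian t (bump \<delta>) (y - x)) / c" for t
      proof -
        have int: "integrable lborel (\<lambda>y. cut u y * bump \<delta> (y - z))" for z
        proof (rule Bochner_Integration.integrable_bound)
          show "integrable lborel (\<lambda>y. M * bump \<delta> (y - z))"
            using integrable_bump_shift[OF \<delta>(1), of z] by simp
          have "\<bar>cut u y * bump \<delta> (y - z)\<bar> \<le> \<bar>M * bump \<delta> (y - z)\<bar>" for y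
            using M[of y] abs_ge_self[of M]
            by (cases "y \<in> K'") (auto simp: abs_mult cut_def intro!: mult_right_mono)
          then show "AE y in lborel. norm (cut u y * bump \<delta> (y - z)) \<le> norm (M * bump \<delta> (y - z))"
            by simp
        qed (use cut(1)[OF cu] bump_meas in auto)
        have "(LINT y|lborel. cut u y * discrete_laplacian t (bump \<delta>) (y - x))
          = (LINT y|lborel. (\<Sum>i\<in>Basis. cut u y * bump \<delta> (y - (x - t *\<^sub>R i))
               + cut u y * bump \<delta> (y - (x + t *\<^sub>R i)) - 2 * (cut u y * bump \<delta> (y - x))) / t\<^sup>2)"
          by (rule Bochner_Integration.integral_cong)
             (simp_all add: discrete_laplacian_def sum_distrib_left algebra_simps)
        also have "\<dots> = (\<Sum>i\<in>Basis. (LINT y|lborel. cut u y * bump \<delta> (y - (x - t *\<^sub>R i)))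
            + (LINT y|lborel. cut u y * bump \<delta> (y - (x + t *\<^sub>R i)))
            - 2 * (LINT y|lborel. cut u y * bump \<delta> (y - x))) / t\<^sup>2"
          using int by simp
        finally show ?thesis
          unfolding discrete_laplacian_def w_def
          by (simp add: sum_divide_distrib add_divide_distrib diff_divide_distrib add_ac mult.commute)
      qed
      have dl_meas: "(\<lambda>y. discrete_laplacian t (bump \<delta>) (y - x)) \<in> borel_measurable borel" for t
      proof -
        have "(\<lambda>y. bump \<delta> (y - x + z)) \<in> borel_measurable borel" for z
          using bump_meas[of "x - z"] by (simp add: algebra_simps)
        from this[of "t *\<^sub>R _"] this[of "- (t *\<^sub>R _)"] show ?thesis
          unfolding discrete_laplacian_def using bump_meas[of x] by simp
      qed
      have "((\<lambda>t. discrete_laplacian t w x)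
          \<longlongrightarrow> (LINT y|lborel. cut u y * laplacian (bump \<delta>) (y - x)) / c) (at 0)"
        unfolding dl
      proof (intro tendsto_divide dominated_convergence_at[OF cut(1)[OF cu] K'(2) M dl_meas _ D] tendsto_const)
        show "(\<lambda>y. laplacian (bump \<delta>) (y - x)) \<in> borel_measurable borel"
          using borel_measurable_continuous_onI[OF test_function_laplacian(1)[OF Tx]]
          unfolding laplacian_shift[abs_def] by simp
        show "((\<lambda>t. discrete_laplacian t (bump \<delta>) (y - x)) \<longlongrightarrow> laplacian (bump \<delta>) (y - x)) (at 0)" for y
          using has_laplacian_test_function[OF T] by (simp add: has_laplacian_def)
      qed (use c in simp)
      moreover have "cut u y * laplacian (bump \<delta>) (y - x) = u y * laplacian ?\<phi> y"
        "cut (\<lambda>y. f (u y)) y * ?\<phi> y = f (u y) * ?\<phi> y" for y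
      proof -
        have cut_mult: "cut g y * r = g y * r" if "y \<notin> cball x \<delta> \<Longrightarrow> r = 0" for g r
          using that sub cut_eq[of y g] by (cases "y \<in> cball x \<delta>") auto
        show "cut u y * laplacian (bump \<delta>) (y - x) = u y * laplacian ?\<phi> y"
          unfolding laplacian_shift[symmetric]
          by (rule cut_mult) (rule test_function_vanishes_outside(2)[OF Tx])
        show "cut (\<lambda>y. f (u y)) y * ?\<phi> y = f (u y) * ?\<phi> y"
          by (rule cut_mult) (rule test_function_vanishes_outside(1)[OF Tx])
      qed
      moreover have "(LINT y|lborel. u y * laplacian ?\<phi> y) = (LINT y|lborel. f (u y) * ?\<phi> y)"
        using u(2) Tx sub K'(3) unfolding weak_solution_iff test_function_def by blast
      ultimately show "has_laplacian w x ((LINT y|lborel. cut (\<lambda>y. f (u y)) y * bump \<delta> (y - x)) / c)"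
        unfolding has_laplacian_def by (simp only:)
      show "\<bar>(LINT y|lborel. cut (\<lambda>y. f (u y)) y * bump \<delta> (y - x)) / c - f (u x)\<bar> \<le> \<eta>"
        using \<delta>2(2) xK'[OF x] \<delta>(4) by (intro average[OF cfu _ x]) auto
    qed
  qed
qed

section \<open>The interior bound\<close>

definition barrier :: "real \<Rightarrow> nat \<Rightarrow> 'a::euclidean_space \<Rightarrow> real" where
  "barrier A p y = A / (1 - y \<bullet> y) ^ p"

text \<open>
With $q = 1 - |y|^2$, the restriction to a coordinate line is $A\,(q - 2 y_i t - t^2)^{-p}$; the
formula collects the second derivatives at $t = 0$.
\<close>

lemma has_laplacian_barrier:
  fixes y :: "'a::euclidean_space" and p :: nat
  assumes "norm y < 1"
  defines "q \<equiv> 1 - y \<bullet> y"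
  shows "has_laplacian (barrier A p) y
    (2 * A * real p * real DIM('a) / q ^ (p + 1) + 4 * A * real p * real (p + 1) * (y \<bullet> y) / q ^ (p + 2))"
proof -
  have q: "q > 0"
    using assms(1) power_strict_mono[of "norm y" 1 2] by (simp add: q_def power2_norm_eq_inner)
  define l where "l = (\<lambda>i. A * real p * (2 / q ^ (p + 1) + (2 * (y \<bullet> i))\<^sup>2 * real (p + 1) / q ^ (p + 2)))"
  have line: "((\<lambda>t. (barrier A p (y + t *\<^sub>R i) + barrier A p (y - t *\<^sub>R i) - 2 * barrier A p y) / t\<^sup>2)
      \<longlongrightarrow> l i) (at 0)" if i: "i \<in> Basis" for i
  proof -
    define Q where "Q = (\<lambda>t. q - 2 * (y \<bullet> i) * t - t\<^sup>2)"
    define P' where "P' = (\<lambda>t. A * real p * (2 * (y \<bullet> i) + 2 * t) / Q t ^ (p + 1))"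
    define P'' where "P'' = (\<lambda>t. A * real p * (2 / Q t ^ (p + 1)
        + (2 * (y \<bullet> i) + 2 * t)\<^sup>2 * real (p + 1) / Q t ^ (p + 2)))"
    have "isCont Q 0" by (auto simp: Q_def)
    then obtain d where d: "d > 0" "\<And>t. \<bar>t\<bar> < d \<Longrightarrow> \<bar>Q t - Q 0\<bar> < q"
      unfolding continuous_at_eps_delta using q by (auto simp: dist_real_def)
    have Qpos: "Q t > 0" if "\<bar>t\<bar> \<le> d / 2" for t
      using d(2)[of t] d(1) that by (auto simp: Q_def abs_if split: if_splits)
    have dQ: "(Q has_real_derivative (- 2 * (y \<bullet> i) - 2 * t)) (at t)" for t
      unfolding Q_def by (auto intro!: derivative_eq_intros)
    have "((\<lambda>t. A / Q t ^ p) has_real_derivative P' t) (at t)" if "\<bar>t\<bar> \<le> d / 2" for t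
      using Qpos[OF that] unfolding P'_def
      by (auto intro!: derivative_eq_intros dQ) (cases p; auto simp: field_simps)
    moreover have "(P' has_real_derivative P'' t) (at t)" if "\<bar>t\<bar> \<le> d / 2" for t
      using Qpos[OF that] unfolding P'_def P''_def
      by (auto intro!: derivative_eq_intros dQ) (cases p; auto simp: field_simps power2_eq_square)
    moreover have "isCont P'' 0"
      unfolding P''_def using q by (auto simp: Q_def intro!: continuous_intros)
    ultimately have "((\<lambda>t. (A / Q t ^ p + A / Q (- t) ^ p - 2 * (A / Q 0 ^ p)) / t\<^sup>2) \<longlongrightarrow> P'' 0) (at 0)"
      using d(1) by (intro symmetric_second_difference_tendsto[where r="d / 2" and p'=P']) auto
    moreover have "barrier A p (y + t *\<^sub>R i) = A / Q t ^ p" "barrier A p (y - t *\<^sub>R i) = A / Q (- t) ^ p" for t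
      using i by (auto simp: barrier_def Q_def q_def inner_simps inner_commute power2_eq_square algebra_simps)
    moreover have "barrier A p y = A / Q 0 ^ p" "P'' 0 = l i"
      by (simp_all add: barrier_def Q_def q_def P''_def l_def)
    ultimately show ?thesis by simp
  qed
  have "(\<Sum>i\<in>Basis. l i) = A * real p * (real DIM('a) * (2 / q ^ (p + 1))
      + (\<Sum>i\<in>Basis. (y \<bullet> i)\<^sup>2) * (4 * real (p + 1) / q ^ (p + 2)))"
    by (simp add: l_def sum_distrib_left[symmetric] sum.distrib sum_distrib_right power_mult_distrib)
       (simp add: sum_divide_distrib[symmetric] sum_distrib_left[symmetric] sum_distrib_right[symmetric] mult_ac)
  also have "(\<Sum>i\<in>Basis. (y \<bullet> i)\<^sup>2) = y \<bullet> y"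
    by (simp add: euclidean_inner[of y y] power2_eq_square)
  finally have "(\<Sum>i\<in>Basis. l i) = 2 * A * real p * real DIM('a) / q ^ (p + 1)
      + 4 * A * real p * real (p + 1) * (y \<bullet> y) / q ^ (p + 2)"
    by (simp add: algebra_simps)
  then show ?thesis using has_laplacian_sum_lines[OF line] by simp
qed

text \<open>
The Laplacian of the barrier is of order $A q^{-p-2}$, while the growth of $f$ yields
$f(s) \ge s^{1+\varepsilon} - |C|$ for $s \ge 1$, of order $A^{1+\varepsilon} q^{-p(1+\varepsilon)}$ on
the barrier. Since $0 < q \le 1$, the choice $p \varepsilon \ge 2$ matches the powers of $q$, and
$A^\varepsilon = c$ absorbs the constants with a margin of 2 to spare.
\<close>

lemma barrier_supersolution:
  assumes eps: "\<epsilon> > 0" and f: "\<And>s. f s * s \<ge> - C + \<bar>s\<bar> powr (2 + \<epsilon>)"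
  obtains A p where "A \<ge> 1" "p \<ge> 1"
    "\<And>(y::'a::euclidean_space) s. norm y < 1 \<Longrightarrow> s \<ge> barrier A p y \<Longrightarrow>
      \<exists>L. has_laplacian (barrier A p) y L \<and> L + 2 \<le> f s"
proof -
  obtain p :: nat where p: "p \<ge> 1" "real p * \<epsilon> \<ge> 2"
  proof -
    obtain n :: nat where n: "2 / \<epsilon> \<le> real n" using real_arch_simple by blast
    have "2 = 2 / \<epsilon> * \<epsilon>" using eps by simp
    also have "\<dots> \<le> real (max 1 n) * \<epsilon>" using n eps by (intro mult_right_mono) auto
    finally show thesis by (intro that[of "max 1 n"]) auto
  qed
  define n where "n = real DIM('a)"
  define c where "c = 2 * real p * n + 4 * real p * real (p + 1) + \<bar>C\<bar> + 2"
  have c: "c \<ge> 1" by (simp add: c_def n_def)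
  define A where "A = c powr (1 / \<epsilon>)"
  have A: "A \<ge> 1" unfolding A_def using c eps by (intro ge_one_powr_ge_zero) auto
  have Aeps: "A powr \<epsilon> = c" using c eps by (simp add: A_def powr_powr)
  show thesis
  proof (rule that[OF A p(1)])
    fix y :: 'a and s assume y: "norm y < 1" and s: "s \<ge> barrier A p y"
    define q where "q = 1 - y \<bullet> y"
    define L where "L = 2 * A * real p * real DIM('a) / q ^ (p + 1) + 4 * A * real p * real (p + 1) * (y \<bullet> y) / q ^ (p + 2)"
    have yy: "y \<bullet> y < 1"
      using y power_strict_mono[of "norm y" 1 2] by (simp add: power2_norm_eq_inner)
    then have q: "0 < q" "q \<le> 1" by (auto simp: q_def)
    define E where "E = A / q ^ (p + 2)"
    have E: "E \<ge> 1" unfolding E_def using A q power_le_one[of q "p + 2"]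
      by (simp add: divide_simps del: power_Suc add_2_eq_Suc')
    define B where "B = barrier A p y"
    have B: "B = A / q ^ p" by (simp add: B_def barrier_def q_def)
    have "B \<ge> A" unfolding B using A q power_le_one[of q p] by (simp add: divide_simps mult_left_le)
    then have B1: "B \<ge> 1" "s \<ge> 1" using A s by (auto simp: B_def)
    have LE: "L \<le> (2 * real p * n + 4 * real p * real (p + 1)) * E"
    proof -
      have "2 * A * real p * real DIM('a) / q ^ (p + 1) \<le> 2 * A * real p * n / q ^ (p + 2)"
        unfolding n_def using A q power_decreasing[of "p + 1" "p + 2" q]
        by (intro divide_left_mono) auto
      moreover have "4 * A * real p * real (p + 1) * (y \<bullet> y) / q ^ (p + 2)
          \<le> 4 * A * real p * real (p + 1) * 1 / q ^ (p + 2)"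
        using A q yy by (intro divide_right_mono mult_left_mono) auto
      ultimately show ?thesis unfolding L_def E_def by (simp add: algebra_simps add_divide_distrib)
    qed
    have "c * E \<le> B powr (1 + \<epsilon>)"
    proof -
      \<comment> \<open>Here $q \le 1$ turns the lower bound on $p \varepsilon$ into an upper bound on a power of \<open>q\<close>.\<close>
      have "(q ^ p) powr \<epsilon> = q powr (real p * \<epsilon>)"
        using q by (simp add: powr_realpow[symmetric] powr_powr)
      also have "\<dots> \<le> q powr 2" using p(2) q by (intro powr_mono') auto
      also have "\<dots> = q\<^sup>2" using q by (simp add: powr_numeral)
      finally have "c / q\<^sup>2 \<le> A powr \<epsilon> / (q ^ p) powr \<epsilon>"
        unfolding Aeps using c q by (intro divide_left_mono) auto
      also have "\<dots> = B powr \<epsilon>" using A q by (simp add: B powr_divide)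
      finally have "B * (c / q\<^sup>2) \<le> B * B powr \<epsilon>" using B1 by (intro mult_left_mono) auto
      also have "\<dots> = B powr (1 + \<epsilon>)" using B1 by (simp add: powr_add)
      finally show ?thesis unfolding B E_def power_add by (simp add: mult.commute)
    qed
    also have "\<dots> \<le> s powr (1 + \<epsilon>)" using s B1 eps by (intro powr_mono2) (auto simp: B_def)
    finally have "c * E \<le> s powr (1 + \<epsilon>)" .
    moreover have "s powr (1 + \<epsilon>) - \<bar>C\<bar> \<le> f s"
    proof -
      have "s * s powr (1 + \<epsilon>) = s powr (2 + \<epsilon>)"
        using B1 powr_add[of s 1 "1 + \<epsilon>"] by simp
      moreover have "\<bar>C\<bar> \<le> s * \<bar>C\<bar>" using B1 mult_right_mono[of 1 s "\<bar>C\<bar>"] by simp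
      ultimately have "s * (s powr (1 + \<epsilon>) - \<bar>C\<bar>) \<le> - C + \<bar>s\<bar> powr (2 + \<epsilon>)"
        using B1 by (simp add: right_diff_distrib)
      also have "\<dots> \<le> s * f s" using f[of s] by (simp add: mult.commute)
      finally show ?thesis using B1 by simp
    qed
    moreover have "L + 2 \<le> c * E - \<bar>C\<bar>"
    proof -
      have "(\<bar>C\<bar> + 2) * 1 \<le> (\<bar>C\<bar> + 2) * E" using E by (intro mult_left_mono) auto
      then show ?thesis using LE by (simp add: c_def algebra_simps)
    qed
    ultimately have "L + 2 \<le> f s" by linarith
    then show "\<exists>L. has_laplacian (barrier A p) y L \<and> L + 2 \<le> f s"
      using has_laplacian_barrier[OF y, of A p] unfolding L_def q_def by blast
  qed
qed

text \<open>
If $u(x) > A$, the mollified solution minus the barrier around $x$ is positive at the centre and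
negative near the unit sphere, hence has an interior maximum at which it is positive. There the
Laplacian of the mollified solution exceeds that of the barrier by at least 1, contrary to the
maximum principle.
\<close>

lemma weak_solution_upper_bound:
  fixes f :: "real \<Rightarrow> real"
  assumes "continuous_on UNIV f" "\<epsilon> > 0" "\<And>s. f s * s \<ge> - C + \<bar>s\<bar> powr (2 + \<epsilon>)"
  obtains A where "\<And>V u (x::'a::euclidean_space). open V \<Longrightarrow> continuous_on V u \<Longrightarrow>
    weak_solution f V u \<Longrightarrow> cball x 1 \<subseteq> V \<Longrightarrow> u x \<le> A"
proof -
  obtain A p where A: "A \<ge> 1" and p: "p \<ge> 1"
    and super: "\<And>(y::'a) s. norm y < 1 \<Longrightarrow> s \<ge> barrier A p y \<Longrightarrow>
      \<exists>L. has_laplacian (barrier A p) y L \<and> L + 2 \<le> f s"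
    using barrier_supersolution[OF assms(2,3), where ?'a='a] by metis
  have "u x \<le> A" if V: "open V" and u: "continuous_on V u" "weak_solution f V u"
    and x: "cball x 1 \<subseteq> V" for V u and x :: 'a
  proof (rule ccontr)
    assume "\<not> u x \<le> A"
    define \<eta> where "\<eta> = min 1 ((u x - A) / 4)"
    have \<eta>: "\<eta> > 0" "\<eta> \<le> 1" "4 * \<eta> \<le> u x - A"
      using \<open>\<not> u x \<le> A\<close> unfolding \<eta>_def by (auto simp: min_def)
    obtain w where w: "continuous_on UNIV w" "\<And>y. y \<in> cball x 1 \<Longrightarrow> \<bar>w y - u y\<bar> \<le> \<eta>"
      "\<And>y. y \<in> cball x 1 \<Longrightarrow> \<exists>L. has_laplacian w y L \<and> \<bar>L - f (u y)\<bar> \<le> \<eta>"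
      using weak_solution_approximation[OF V u assms(1) compact_cball x \<eta>(1)] by metis
    have "bounded (w ` cball x 1)"
      using w(1) by (intro compact_imp_bounded compact_continuous_image continuous_on_subset[OF w(1)]) auto
    then obtain m where m: "m > 0" "\<And>y. y \<in> cball x 1 \<Longrightarrow> \<bar>w y\<bar> \<le> m"
      by (auto simp: bounded_pos)
    \<comment> \<open>On the sphere of radius \<open>\<rho>\<close> the barrier is at least $m + 1$, because \<open>A\<close> and \<open>p\<close> are at least 1.\<close>
    define \<rho> where "\<rho> = sqrt (1 - 1 / (m + 1))"
    have \<rho>2: "\<rho>\<^sup>2 = 1 - 1 / (m + 1)" using m(1) by (simp add: \<rho>_def)
    have \<rho>: "0 < \<rho>" "\<rho> < 1" unfolding \<rho>_def using m(1) by auto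
    define b where "b = (\<lambda>y. barrier A p (y - x))"
    have sub: "cball x \<rho> \<subseteq> cball x 1" using \<rho> by auto
    have norm_lt: "norm (y - x) < 1" if "y \<in> cball x \<rho>" for y
      using that \<rho> by (auto simp: dist_norm norm_minus_commute)
    have pos: "1 - (y - x) \<bullet> (y - x) > 0" if "y \<in> cball x \<rho>" for y
      using power_strict_mono[OF norm_lt[OF that], of 2] by (simp add: power2_norm_eq_inner)
    have "continuous_on (cball x \<rho>) (\<lambda>y. w y - b y)"
      unfolding b_def barrier_def using pos
      by (intro continuous_intros continuous_on_subset[OF w(1)]) force+
    then obtain y where y: "y \<in> cball x \<rho>"
      and max: "\<And>z. z \<in> cball x \<rho> \<Longrightarrow> w z - b z \<le> w y - b y"
      using continuous_attains_sup[of "cball x \<rho>" "\<lambda>y. w y - b y"] \<rho> by fastforce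
    have "b x = A" by (simp add: b_def barrier_def)
    then have big: "w y - b y \<ge> 3 * \<eta>"
      using max[of x] w(2)[of x] \<rho> \<eta>(3) by simp
    have "dist x y < \<rho>"
    proof (rule ccontr)
      assume "\<not> dist x y < \<rho>"
      then have "norm (y - x) = \<rho>" using y by (simp add: dist_norm norm_minus_commute)
      then have q: "1 - (y - x) \<bullet> (y - x) = 1 / (m + 1)"
        using \<rho>2 by (simp add: power2_norm_eq_inner[symmetric])
      have "(m + 1) ^ 1 \<le> (m + 1) ^ p" using p m(1) by (intro power_increasing) auto
      then have "1 * (m + 1) \<le> A * (m + 1) ^ p" using A m(1) by (intro mult_mono) auto
      also have "A * (m + 1) ^ p = b y"
        unfolding b_def barrier_def q by (simp add: power_divide)
      finally show False using big m(2)[of y] y sub \<eta>(1) by auto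
    qed
    have "u y \<ge> b y" using big w(2)[of y] y sub \<eta>(1) by (smt (verit) subsetD)
    then obtain M where M: "has_laplacian (barrier A p) (y - x) M" "M + 2 \<le> f (u y)"
      using super[OF norm_lt[OF y]] unfolding b_def by blast
    obtain L where L: "has_laplacian w y L" "\<bar>L - f (u y)\<bar> \<le> \<eta>"
      using w(3) y sub by blast
    have "L - M \<le> 0"
    proof (rule has_laplacian_at_max)
      show "has_laplacian (\<lambda>y. w y - b y) y (L - M)"
        unfolding b_def by (intro has_laplacian_diff L(1) has_laplacian_shift M(1))
      show "\<rho> - dist x y > 0" using \<open>dist x y < \<rho>\<close> by simp
      show "w z - b z \<le> w y - b y" if "z \<in> ball y (\<rho> - dist x y)" for z
        using that dist_triangle[of x z y] by (intro max) (auto simp: dist_commute)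
    qed
    then show False using L(2) M(2) \<eta>(2) by linarith
  qed
  then show thesis using that by blast
qed

lemma weak_solution_interior_bound:
  fixes f :: "real \<Rightarrow> real"
  assumes f: "continuous_on UNIV f" "\<epsilon> > 0" "\<And>s. f s * s \<ge> - C + \<bar>s\<bar> powr (2 + \<epsilon>)"
  obtains A where "\<And>V u (x::'a::euclidean_space). open V \<Longrightarrow> continuous_on V u \<Longrightarrow>
    weak_solution f V u \<Longrightarrow> cball x 1 \<subseteq> V \<Longrightarrow> \<bar>u x\<bar> \<le> A"
proof -
  obtain A where A: "\<And>V u (x::'a). open V \<Longrightarrow> continuous_on V u \<Longrightarrow>
    weak_solution f V u \<Longrightarrow> cball x 1 \<subseteq> V \<Longrightarrow> u x \<le> A"
    using weak_solution_upper_bound[OF f] by metis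
  have f': "continuous_on UNIV (\<lambda>s. - f (- s))"
    by (intro continuous_intros continuous_on_compose2[OF f(1)]) auto
  have "- f (- s) * s \<ge> - C + \<bar>s\<bar> powr (2 + \<epsilon>)" for s using f(3)[of "- s"] by simp
  then obtain B where B: "\<And>V u (x::'a). open V \<Longrightarrow> continuous_on V u \<Longrightarrow>
    weak_solution (\<lambda>s. - f (- s)) V u \<Longrightarrow> cball x 1 \<subseteq> V \<Longrightarrow> u x \<le> B"
    using weak_solution_upper_bound[OF f' f(2)] by metis
  show thesis
  proof (rule that[of "max A B"])
    fix V u and x :: 'a
    assume *: "open V" "continuous_on V u" "weak_solution f V u" "cball x 1 \<subseteq> V"
    have "- u x \<le> B"
      by (rule B[OF *(1) continuous_on_minus[OF *(2)] weak_solution_uminus[OF *(3)] *(4)])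
    then show "\<bar>u x\<bar> \<le> max A B" using A[OF *] by linarith
  qed
qed

section \<open>The interior Lipschitz estimate\<close>

text \<open>
The mirror image of \<open>x\<close> in the hyperplane through \<open>a\<close> orthogonal to the unit vector \<open>e\<close>.
\<close>

definition reflect :: "'a::euclidean_space \<Rightarrow> 'a \<Rightarrow> 'a \<Rightarrow> 'a" where
  "reflect a e x = x - (2 * ((x - a) \<bullet> e)) *\<^sub>R e"

lemma has_laplacian_reflect:
  assumes "has_laplacian w (reflect a e y) L" "e \<in> Basis"
  shows "has_laplacian (\<lambda>x. w (reflect a e x)) y L"
proof -
  have "reflect a e (y + t *\<^sub>R i) = reflect a e y + (if i = e then - t else t) *\<^sub>R i" if "i \<in> Basis" for t i
    using that assms(2)
    by (auto simp: reflect_def inner_simps inner_Basis algebra_simps)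
       (metis mult.commute mult_2 scaleR_add_left)
  from this this[where t="- _"]
  have "w (reflect a e (y + t *\<^sub>R i)) + w (reflect a e (y - t *\<^sub>R i))
      = w (reflect a e y + t *\<^sub>R i) + w (reflect a e y - t *\<^sub>R i)" if "i \<in> Basis" for t i
    using that by simp
  then have "discrete_laplacian t (\<lambda>x. w (reflect a e x)) y = discrete_laplacian t w (reflect a e y)" for t
    by (simp add: discrete_laplacian_def)
  then show ?thesis using assms(1) by (simp add: has_laplacian_def)
qed

lemma dist_reflect:
  assumes "norm e = 1"
  shows "dist a (reflect a e x) = dist a x"
proof -
  have "(norm (reflect a e x - a))\<^sup>2 = (norm (x - a))\<^sup>2"
  proof -
    have "reflect a e x - a = (x - a) - (2 * ((x - a) \<bullet> e)) *\<^sub>R e" by (simp add: reflect_def)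
    moreover have "e \<bullet> e = 1" using assms by (simp add: norm_eq_1)
    ultimately show ?thesis
      by (simp only: power2_norm_eq_inner) (simp add: inner_simps inner_commute algebra_simps)
  qed
  then show ?thesis by (simp add: dist_norm norm_minus_commute)
qed

text \<open>
The first summand dominates on the spherical part of the boundary of the half ball, the second one
is nonnegative in the half ball and, being concave in the direction of \<open>e\<close>, makes the Laplacian
as negative as desired.
\<close>

definition half_ball_barrier :: "real \<Rightarrow> real \<Rightarrow> 'a::euclidean_space \<Rightarrow> 'a \<Rightarrow> 'a \<Rightarrow> real" where
  "half_ball_barrier b \<kappa> a e x = b * ((x - a) \<bullet> (x - a)) + \<kappa> * ((x - a) \<bullet> e) * (2 - (x - a) \<bullet> e)"

lemma has_laplacian_half_ball_barrier:
  fixes a :: "'a::euclidean_space"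
  assumes e: "e \<in> Basis"
  shows "has_laplacian (half_ball_barrier b \<kappa> a e) y (2 * b * real DIM('a) - 2 * \<kappa>)"
proof -
  let ?g = "half_ball_barrier b \<kappa> a e"
  have "((\<lambda>t. (?g (y + t *\<^sub>R i) + ?g (y - t *\<^sub>R i) - 2 * ?g y) / t\<^sup>2)
      \<longlongrightarrow> 2 * b - (if i = e then 2 * \<kappa> else 0)) (at 0)" if i: "i \<in> Basis" for i
  proof (rule tendsto_eventually)
    have "?g (y + t *\<^sub>R i) + ?g (y - t *\<^sub>R i) - 2 * ?g y = (2 * b - (if i = e then 2 * \<kappa> else 0)) * t\<^sup>2" for t
    proof -
      define z where "z = y - a"
      have "y + t *\<^sub>R i - a = z + t *\<^sub>R i" "y - t *\<^sub>R i - a = z - t *\<^sub>R i" by (simp_all add: z_def)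
      then show ?thesis
        using i e unfolding half_ball_barrier_def z_def[symmetric]
        by (auto simp: inner_simps inner_Basis inner_commute power2_eq_square algebra_simps)
    qed
    then show "\<forall>\<^sub>F t in at 0. (?g (y + t *\<^sub>R i) + ?g (y - t *\<^sub>R i) - 2 * ?g y) / t\<^sup>2
        = 2 * b - (if i = e then 2 * \<kappa> else 0)"
      by (simp add: eventually_at_filter)
  qed
  then have "has_laplacian ?g y (\<Sum>i\<in>Basis. 2 * b - (if i = e then 2 * \<kappa> else 0))"
    by (rule has_laplacian_sum_lines)
  then show ?thesis using e by (simp add: sum_subtractf mult_ac)
qed

text \<open>
The function $w(x) - w(Rx)$, with $w$ a mollified solution and $R$ the reflection in the hyperplane
through $a$, vanishes on that hyperplane, is at most $2(M+1)$ on the unit sphere, and its Laplacian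
is at least $-2N - 1$. The constant $\kappa$ is chosen so that the Laplacian of the barrier is
$-(2N + 3)$; hence the difference stays below the barrier in the half ball, and on the axis the
barrier is at most a constant multiple of the distance to the hyperplane.
\<close>

lemma symmetric_difference_upper_bound:
  fixes a :: "'a::euclidean_space"
  assumes V: "open V" and u: "continuous_on V u" "weak_solution f V u"
    and f: "continuous_on UNIV f" and a: "cball a 1 \<subseteq> V" and e: "e \<in> Basis"
    and M: "\<And>y. y \<in> cball a 1 \<Longrightarrow> \<bar>u y\<bar> \<le> M" and N: "\<And>y. y \<in> cball a 1 \<Longrightarrow> \<bar>f (u y)\<bar> \<le> N"
    and t: "0 \<le> t" "t \<le> 1"
  defines "\<kappa> \<equiv> 2 * real DIM('a) * (M + 1) + N + 3 / 2"
  shows "u (a + t *\<^sub>R e) - u (a - t *\<^sub>R e) \<le> (2 * (M + 1) + 2 * \<kappa>) * t"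
proof (rule field_le_epsilon)
  fix \<gamma> :: real assume "\<gamma> > 0"
  define \<eta> where "\<eta> = min (1 / 2) (\<gamma> / 2)"
  have \<eta>: "\<eta> > 0" "\<eta> \<le> 1 / 2" "2 * \<eta> \<le> \<gamma>" using \<open>\<gamma> > 0\<close> by (auto simp: \<eta>_def)
  have MN: "M \<ge> 0" "N \<ge> 0" using M[of a] N[of a] by auto
  then have \<kappa>: "\<kappa> \<ge> 0" by (simp add: \<kappa>_def)
  have e1: "norm e = 1" using e by simp
  obtain w where w: "continuous_on UNIV w" "\<And>y. y \<in> cball a 1 \<Longrightarrow> \<bar>w y - u y\<bar> \<le> \<eta>"
    "\<And>y. y \<in> cball a 1 \<Longrightarrow> \<exists>L. has_laplacian w y L \<and> \<bar>L - f (u y)\<bar> \<le> \<eta>"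
    using weak_solution_approximation[OF V u f compact_cball a \<eta>(1)] by metis
  let ?R = "reflect a e" and ?\<Psi> = "half_ball_barrier (2 * (M + 1)) \<kappa> a e"
  define g where "g = (\<lambda>y. (w y - w (?R y)) - ?\<Psi> y)"
  define H where "H = cball a 1 \<inter> {y. a \<bullet> e \<le> y \<bullet> e}"
  have R: "?R y \<in> cball a 1" if "y \<in> cball a 1" for y using that dist_reflect[OF e1, of a y] by simp
  have cR: "continuous_on UNIV ?R"
    unfolding reflect_def by (intro continuous_intros)
  have "continuous_on UNIV g"
    unfolding g_def half_ball_barrier_def
    by (intro continuous_intros w(1) continuous_on_compose2[OF w(1) cR]) auto
  then have cg: "continuous_on H g" by (rule continuous_on_subset) simp
  have "compact H" unfolding H_def
    by (intro compact_Int_closed closed_Collect_le continuous_intros) auto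
  moreover have "a \<in> H" by (simp add: H_def)
  ultimately obtain y where y: "y \<in> H" and max: "\<And>z. z \<in> H \<Longrightarrow> g z \<le> g y"
    using continuous_attains_sup[OF _ _ cg] by blast
  have y1: "y \<in> cball a 1" "(y - a) \<bullet> e \<ge> 0" using y by (auto simp: H_def inner_diff_left)
  have ye: "(y - a) \<bullet> e \<le> 1"
    using norm_cauchy_schwarz[of "y - a" e] y1(1) e1 by (simp add: dist_norm norm_minus_commute)
  have \<Psi>_pos: "\<kappa> * ((y - a) \<bullet> e) * (2 - (y - a) \<bullet> e) \<ge> 0"
    using \<kappa> y1(2) ye by (intro mult_nonneg_nonneg) auto
  consider "y \<bullet> e = a \<bullet> e" | "dist a y = 1" | "y \<bullet> e > a \<bullet> e" "dist a y < 1"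
    using y by (fastforce simp: H_def)
  then have "g y \<le> 0"
  proof cases
    case 1
    then have "?R y = y" by (simp add: reflect_def inner_diff_left)
    moreover have "?\<Psi> y \<ge> 0"
      unfolding half_ball_barrier_def using MN by (intro add_nonneg_nonneg \<Psi>_pos) simp
    ultimately show ?thesis by (simp add: g_def)
  next
    case 2
    then have "(y - a) \<bullet> (y - a) = 1"
      by (simp add: dist_norm norm_minus_commute power2_norm_eq_inner[symmetric])
    then have "?\<Psi> y \<ge> 2 * (M + 1)" using \<Psi>_pos by (simp add: half_ball_barrier_def)
    moreover have "\<bar>w y\<bar> \<le> M + 1" "\<bar>w (?R y)\<bar> \<le> M + 1"
      using w(2)[OF y1(1)] w(2)[OF R[OF y1(1)]] M[OF y1(1)] M[OF R[OF y1(1)]] \<eta>(2) by linarith+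
    ultimately show ?thesis by (simp add: g_def)
  next
    case 3
    obtain L where L: "has_laplacian w y L" "\<bar>L - f (u y)\<bar> \<le> \<eta>" using w(3)[OF y1(1)] by blast
    obtain L' where L': "has_laplacian w (?R y) L'" "\<bar>L' - f (u (?R y))\<bar> \<le> \<eta>"
      using w(3)[OF R[OF y1(1)]] by blast
    have "open (ball a 1 \<inter> {y. a \<bullet> e < y \<bullet> e})"
      by (intro open_Int open_ball open_Collect_less continuous_intros)
    moreover have "y \<in> ball a 1 \<inter> {y. a \<bullet> e < y \<bullet> e}" using 3 by simp
    ultimately obtain \<delta> where \<delta>: "\<delta> > 0" "ball y \<delta> \<subseteq> ball a 1 \<inter> {y. a \<bullet> e < y \<bullet> e}"
      using open_contains_ball by blast
    have "(L - L') - (2 * (2 * (M + 1)) * real DIM('a) - 2 * \<kappa>) \<le> 0"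
    proof (rule has_laplacian_at_max[OF _ \<delta>(1)])
      show "has_laplacian g y ((L - L') - (2 * (2 * (M + 1)) * real DIM('a) - 2 * \<kappa>))"
        unfolding g_def
        by (intro has_laplacian_diff L(1) has_laplacian_reflect[OF L'(1) e] has_laplacian_half_ball_barrier[OF e])
      show "g z \<le> g y" if "z \<in> ball y \<delta>" for z
        using \<delta>(2) that by (intro max) (auto simp: H_def)
    qed
    moreover have "2 * (2 * (M + 1)) * real DIM('a) - 2 * \<kappa> = - (2 * N + 3)"
      by (simp add: \<kappa>_def algebra_simps)
    moreover have "L - L' \<ge> - (2 * N) - 2 * \<eta>"
      using L(2) L'(2) N[OF y1(1)] N[OF R[OF y1(1)]] by linarith
    ultimately show ?thesis using \<eta>(2) by linarith
  qed
  moreover have te: "a + t *\<^sub>R e \<in> cball a 1" "a - t *\<^sub>R e \<in> cball a 1"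
    using t e1 by (auto simp: dist_norm)
  moreover have ee: "e \<bullet> e = 1" using e by simp
  then have "a + t *\<^sub>R e \<in> H" using te t by (auto simp: H_def inner_simps)
  ultimately have "g (a + t *\<^sub>R e) \<le> 0" using max by force
  moreover have "?R (a + t *\<^sub>R e) = a - t *\<^sub>R e"
    using ee by (simp add: reflect_def algebra_simps) (simp add: scaleR_2[symmetric] mult.commute)
  moreover have "?\<Psi> (a + t *\<^sub>R e) \<le> (2 * (M + 1) + 2 * \<kappa>) * t"
  proof -
    have "?\<Psi> (a + t *\<^sub>R e) = 2 * (M + 1) * (t * t) + \<kappa> * (t * (2 - t))"
      using ee by (simp add: half_ball_barrier_def)
    moreover have "2 * (M + 1) * (t * t) \<le> 2 * (M + 1) * t"
      using MN t by (intro mult_left_mono) (auto simp: mult_left_le)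
    moreover have "\<kappa> * (t * (2 - t)) \<le> \<kappa> * (t * 2)"
      using \<kappa> t by (intro mult_left_mono) auto
    ultimately show ?thesis by (simp add: algebra_simps)
  qed
  ultimately have "w (a + t *\<^sub>R e) - w (a - t *\<^sub>R e) \<le> (2 * (M + 1) + 2 * \<kappa>) * t"
    by (simp add: g_def)
  then show "u (a + t *\<^sub>R e) - u (a - t *\<^sub>R e) \<le> (2 * (M + 1) + 2 * \<kappa>) * t + \<gamma>"
    using w(2)[OF te(1)] w(2)[OF te(2)] \<eta>(3) by linarith
qed

lemma symmetric_difference_bound:
  fixes a :: "'a::euclidean_space"
  assumes V: "open V" and u: "continuous_on V u" "weak_solution f V u"
    and f: "continuous_on UNIV f" and a: "cball a 1 \<subseteq> V" and e: "e \<in> Basis"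
    and M: "\<And>y. y \<in> cball a 1 \<Longrightarrow> \<bar>u y\<bar> \<le> M" and N: "\<And>y. y \<in> cball a 1 \<Longrightarrow> \<bar>f (u y)\<bar> \<le> N"
    and t: "\<bar>t\<bar> \<le> 1"
  defines "\<kappa> \<equiv> 2 * real DIM('a) * (M + 1) + N + 3 / 2"
  shows "\<bar>u (a + t *\<^sub>R e) - u (a - t *\<^sub>R e)\<bar> \<le> (2 * (M + 1) + 2 * \<kappa>) * \<bar>t\<bar>"
proof -
  have f': "continuous_on UNIV (\<lambda>s. - f (- s))"
    by (intro continuous_intros continuous_on_compose2[OF f]) auto
  have "u (a + \<bar>t\<bar> *\<^sub>R e) - u (a - \<bar>t\<bar> *\<^sub>R e) \<le> (2 * (M + 1) + 2 * \<kappa>) * \<bar>t\<bar>"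
    unfolding \<kappa>_def
    by (rule symmetric_difference_upper_bound[OF V u f a e M N]) (use t in auto)
  moreover have "- u (a + \<bar>t\<bar> *\<^sub>R e) - - u (a - \<bar>t\<bar> *\<^sub>R e) \<le> (2 * (M + 1) + 2 * \<kappa>) * \<bar>t\<bar>"
    unfolding \<kappa>_def
    by (rule symmetric_difference_upper_bound[OF V continuous_on_minus[OF u(1)]
          weak_solution_uminus[OF u(2)] f' a e]) (use M N t in auto)
  ultimately show ?thesis by (cases "t \<ge> 0") (auto simp: abs_if)
qed

text \<open>
A displacement $h$ is decomposed into one step along each coordinate axis. All partial sums, and
the midpoints of the steps, have norm at most $|h| \le 1$, so the unit balls around the midpoints
stay in the ball of radius 2 where $u$ is bounded by $M$.
\<close>

lemma weak_solution_interior_lipschitz: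
  fixes f :: "real \<Rightarrow> real"
  assumes f: "continuous_on UNIV f"
  obtains L where "\<And>V u (x::'a::euclidean_space) h. open V \<Longrightarrow> continuous_on V u \<Longrightarrow>
    weak_solution f V u \<Longrightarrow> cball x 2 \<subseteq> V \<Longrightarrow> (\<And>y. y \<in> cball x 2 \<Longrightarrow> \<bar>u y\<bar> \<le> M) \<Longrightarrow>
    norm h \<le> 1 \<Longrightarrow> \<bar>u (x + h) - u x\<bar> \<le> L * norm h"
proof -
  have "compact (f ` {-M..M})"
    by (intro compact_continuous_image continuous_on_subset[OF f]) auto
  then obtain N where N: "\<And>s. \<bar>s\<bar> \<le> M \<Longrightarrow> \<bar>f s\<bar> \<le> N"
    by (force dest!: compact_imp_bounded simp: bounded_iff abs_le_iff)
  define \<kappa> where "\<kappa> = 2 * real DIM('a) * (M + 1) + N + 3 / 2"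
  define c where "c = (2 * (M + 1) + 2 * \<kappa>) / 2"
  have "\<bar>u (x + h) - u x\<bar> \<le> (real DIM('a) * c) * norm h"
    if V: "open V" and u: "continuous_on V u" "weak_solution f V u" and x: "cball x 2 \<subseteq> V"
      and M: "\<And>y. y \<in> cball x 2 \<Longrightarrow> \<bar>u y\<bar> \<le> M" and h: "norm h \<le> 1" for V u and x h :: 'a
  proof -
    have M0: "M \<ge> 0" using M[of x] by auto
    then have "N \<ge> 0" using N[of 0] by auto
    then have c: "c \<ge> 0" using M0 by (simp add: c_def \<kappa>_def)
    have step: "\<bar>u (p + s *\<^sub>R i) - u p\<bar> \<le> c * \<bar>s\<bar>"
      if i: "i \<in> Basis" and p: "norm (p + (s / 2) *\<^sub>R i - x) \<le> 1" and s: "\<bar>s\<bar> \<le> 1" for p s i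
    proof -
      let ?m = "p + (s / 2) *\<^sub>R i"
      have sub: "cball ?m 1 \<subseteq> cball x 2"
      proof
        fix z assume "z \<in> cball ?m 1"
        then show "z \<in> cball x 2"
          using p dist_triangle[of x z ?m] by (simp add: dist_norm norm_minus_commute)
      qed
      have "\<bar>u (?m + (s / 2) *\<^sub>R i) - u (?m - (s / 2) *\<^sub>R i)\<bar> \<le> (2 * (M + 1) + 2 * \<kappa>) * \<bar>s / 2\<bar>"
        unfolding \<kappa>_def
        by (rule symmetric_difference_bound[OF V u f _ i]) (use sub x M N s in auto)
      moreover have "?m + (s / 2) *\<^sub>R i = p + s *\<^sub>R i" "?m - (s / 2) *\<^sub>R i = p"
        by (simp_all add: add.assoc scaleR_add_left[symmetric])
      ultimately show ?thesis by (simp add: c_def)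
    qed
    have "\<bar>u (x + (\<Sum>i\<in>S. (h \<bullet> i) *\<^sub>R i)) - u x\<bar> \<le> (\<Sum>i\<in>S. c * \<bar>h \<bullet> i\<bar>)"
      if "finite S" "S \<subseteq> Basis" for S
      using that
    proof (induction S rule: finite_induct)
      case (insert i S)
      let ?p = "x + (\<Sum>i\<in>S. (h \<bullet> i) *\<^sub>R i)"
      have i: "i \<in> Basis" and S: "S \<subseteq> Basis" using insert.prems by auto
      have "norm (?p + ((h \<bullet> i) / 2) *\<^sub>R i - x) \<le> norm h"
      proof (rule norm_le_componentwise)
        fix b :: 'a assume b: "b \<in> Basis"
        have "(\<Sum>j\<in>S. (h \<bullet> j) *\<^sub>R j) \<bullet> b = (\<Sum>j\<in>S. if j = b then h \<bullet> b else 0)"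
          unfolding inner_sum_left using S b by (intro sum.cong) (auto simp: inner_Basis)
        also have "\<dots> = (if b \<in> S then h \<bullet> b else 0)" using insert.hyps(1) by simp
        finally have "(?p + ((h \<bullet> i) / 2) *\<^sub>R i - x) \<bullet> b
            = (if b \<in> S then h \<bullet> b else 0) + (if b = i then h \<bullet> i / 2 else 0)"
          using i b by (auto simp: inner_simps inner_Basis)
        then show "\<bar>(?p + ((h \<bullet> i) / 2) *\<^sub>R i - x) \<bullet> b\<bar> \<le> \<bar>h \<bullet> b\<bar>"
          using insert.hyps(2) by auto
      qed
      then have "\<bar>u (?p + (h \<bullet> i) *\<^sub>R i) - u ?p\<bar> \<le> c * \<bar>h \<bullet> i\<bar>"
        using h Basis_le_norm[OF i, of h] by (intro step i) auto
      moreover have "?p + (h \<bullet> i) *\<^sub>R i = x + (\<Sum>i\<in>insert i S. (h \<bullet> i) *\<^sub>R i)"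
        using insert.hyps by (simp add: add_ac)
      ultimately show ?case using insert.IH[OF S] insert.hyps by auto
    qed simp
    from this[OF finite_Basis order_refl]
    have "\<bar>u (x + h) - u x\<bar> \<le> (\<Sum>i\<in>Basis. c * \<bar>h \<bullet> i\<bar>)" by (simp add: euclidean_representation)
    also have "\<dots> \<le> (\<Sum>i\<in>(Basis::'a set). c * norm h)"
      using c by (intro sum_mono mult_left_mono Basis_le_norm) auto
    finally show ?thesis by simp
  qed
  then show thesis using that by blast
qed

section \<open>Compactness\<close>

lemma small_radius:
  fixes L e :: real
  assumes "e > 0"
  obtains \<delta> where "\<delta> > 0" "\<delta> \<le> 1" "\<bar>L\<bar> * \<delta> \<le> e"
proof (rule that[of "min 1 (e / (\<bar>L\<bar> + 1))"])
  have "\<bar>L\<bar> * min 1 (e / (\<bar>L\<bar> + 1)) \<le> (\<bar>L\<bar> + 1) * (e / (\<bar>L\<bar> + 1))"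
    using assms by (intro mult_mono) auto
  then show "\<bar>L\<bar> * min 1 (e / (\<bar>L\<bar> + 1)) \<le> e" by simp
qed (use assms in auto)

text \<open>
A diagonal argument gives convergence on a countable dense set; the common Lipschitz constant,
which at each point is only required for large $n$, extends it to all points.
\<close>

lemma equi_lipschitz_subsequence:
  fixes U :: "nat \<Rightarrow> 'a::euclidean_space \<Rightarrow> real"
  assumes bdd: "\<And>n z. \<bar>U n z\<bar> \<le> M"
    and lip: "\<And>z. \<forall>\<^sub>F n in sequentially. \<forall>h. norm h \<le> 1 \<longrightarrow> \<bar>U n (z + h) - U n z\<bar> \<le> L * norm h"
  obtains k v where "strict_mono (k::nat \<Rightarrow> nat)" "\<And>z. (\<lambda>n. U (k n) z) \<longlonglongrightarrow> v z"
proof -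
  obtain D :: "'a set" where D: "countable D" "\<And>X. open X \<Longrightarrow> X \<noteq> {} \<Longrightarrow> \<exists>d\<in>D. d \<in> X"
    using countable_dense_setE by blast
  obtain k where k: "strict_mono (k::nat \<Rightarrow> nat)" "\<And>x. x \<in> D \<Longrightarrow> \<exists>l. (\<lambda>n. U (k n) x) \<longlonglongrightarrow> l"
    using function_convergent_subsequence[OF D(1), of U M] bdd by auto
  have "Cauchy (\<lambda>n. U (k n) z)" for z
    unfolding Cauchy_def
  proof (intro allI impI)
    fix e :: real assume "e > 0"
    obtain \<delta> where \<delta>: "\<delta> > 0" "\<delta> \<le> 1" and L\<delta>: "\<bar>L\<bar> * \<delta> \<le> e / 4"
      using small_radius[of "e / 4" L] \<open>e > 0\<close> by auto
    obtain q where q: "q \<in> D" "q \<in> ball z \<delta>" using D(2)[of "ball z \<delta>"] \<delta>(1) by auto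
    define h where "h = q - z"
    have h: "norm h \<le> \<delta>" "q = z + h" using q by (auto simp: h_def dist_norm norm_minus_commute)
    have "\<forall>\<^sub>F n in sequentially. \<forall>h. norm h \<le> 1 \<longrightarrow> \<bar>U (k n) (z + h) - U (k n) z\<bar> \<le> L * norm h"
      using eventually_subseq[OF k(1) lip[of z]] .
    then have "\<forall>\<^sub>F n in sequentially. \<bar>U (k n) q - U (k n) z\<bar> \<le> e / 4"
    proof eventually_elim
      case (elim n)
      then have "\<bar>U (k n) q - U (k n) z\<bar> \<le> L * norm h" using h \<delta>(2) by simp
      also have "\<dots> \<le> \<bar>L\<bar> * \<delta>" using h by (intro mult_mono) auto
      finally show ?case using L\<delta> by simp
    qed
    then obtain N1 where N1: "\<And>n. n \<ge> N1 \<Longrightarrow> \<bar>U (k n) q - U (k n) z\<bar> \<le> e / 4"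
      by (auto simp: eventually_sequentially)
    have "Cauchy (\<lambda>n. U (k n) q)" using k(2)[OF q(1)] convergent_eq_Cauchy by blast
    then obtain N2 where N2: "\<And>m n. m \<ge> N2 \<Longrightarrow> n \<ge> N2 \<Longrightarrow> \<bar>U (k m) q - U (k n) q\<bar> < e / 4"
      unfolding Cauchy_def dist_real_def using \<open>e > 0\<close> by (meson divide_pos_pos zero_less_numeral)
    show "\<exists>N. \<forall>m\<ge>N. \<forall>n\<ge>N. dist (U (k m) z) (U (k n) z) < e"
    proof (intro exI[of _ "max N1 N2"] allI impI)
      fix m n assume "m \<ge> max N1 N2" "n \<ge> max N1 N2"
      then have "\<bar>U (k m) q - U (k m) z\<bar> \<le> e / 4" "\<bar>U (k n) q - U (k n) z\<bar> \<le> e / 4"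
        "\<bar>U (k m) q - U (k n) q\<bar> < e / 4"
        using N1 N2 by auto
      then show "dist (U (k m) z) (U (k n) z) < e" using \<open>e > 0\<close> unfolding dist_real_def by linarith
    qed
  qed
  then have "(\<lambda>n. U (k n) z) \<longlonglongrightarrow> lim (\<lambda>n. U (k n) z)" for z
    by (simp add: Cauchy_convergent_iff convergent_LIMSEQ_iff)
  then show thesis by (rule that[OF k(1)])
qed

lemma equi_lipschitz_limit:
  fixes U :: "nat \<Rightarrow> 'a::euclidean_space \<Rightarrow> real"
  assumes lip: "\<forall>\<^sub>F n in sequentially. \<forall>h. norm h \<le> 1 \<longrightarrow> \<bar>U n (z + h) - U n z\<bar> \<le> L * norm h"
    and lim: "\<And>z. (\<lambda>n. U n z) \<longlonglongrightarrow> v z" and h: "norm h \<le> 1"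
  shows "\<bar>v (z + h) - v z\<bar> \<le> L * norm h"
proof (rule tendsto_upperbound)
  show "(\<lambda>n. \<bar>U n (z + h) - U n z\<bar>) \<longlonglongrightarrow> \<bar>v (z + h) - v z\<bar>"
    by (intro tendsto_intros lim)
  show "\<forall>\<^sub>F n in sequentially. \<bar>U n (z + h) - U n z\<bar> \<le> L * norm h"
    using lip by eventually_elim (use h in blast)
qed simp

lemma equi_lipschitz_uniform_on_compact:
  fixes U :: "nat \<Rightarrow> 'a::euclidean_space \<Rightarrow> real"
  assumes lip: "\<And>z. \<forall>\<^sub>F n in sequentially. \<forall>h. norm h \<le> 1 \<longrightarrow> \<bar>U n (z + h) - U n z\<bar> \<le> L * norm h"
    and lim: "\<And>z. (\<lambda>n. U n z) \<longlonglongrightarrow> v z" and K: "compact K" and \<eta>: "\<eta> > 0"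
  shows "\<forall>\<^sub>F n in sequentially. \<forall>y\<in>K. \<bar>U n y - v y\<bar> \<le> \<eta>"
proof -
  obtain \<delta> where \<delta>: "\<delta> > 0" "\<delta> \<le> 1" and L\<delta>: "\<bar>L\<bar> * \<delta> \<le> \<eta> / 4"
    using small_radius[of "\<eta> / 4" L] \<eta> by auto
  obtain F where F: "finite F" "K \<subseteq> (\<Union>a\<in>F. ball a \<delta>)"
    using compactE_image[OF K, of K "\<lambda>a. ball a \<delta>"] \<delta>(1) by (metis UN_I centre_in_ball open_ball subsetI)
  have "\<forall>\<^sub>F n in sequentially. \<forall>a\<in>F. \<bar>U n a - v a\<bar> \<le> \<eta> / 4 \<and>
      (\<forall>h. norm h \<le> 1 \<longrightarrow> \<bar>U n (a + h) - U n a\<bar> \<le> L * norm h)"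
    unfolding eventually_ball_finite_distrib[OF F(1)]
  proof (intro ballI eventually_conj lip)
    fix a
    have "\<forall>\<^sub>F n in sequentially. dist (U n a) (v a) < \<eta> / 4"
      using \<eta> by (intro tendstoD[OF lim]) simp
    then show "\<forall>\<^sub>F n in sequentially. \<bar>U n a - v a\<bar> \<le> \<eta> / 4"
      by eventually_elim (simp add: dist_real_def)
  qed
  then show "\<forall>\<^sub>F n in sequentially. \<forall>y\<in>K. \<bar>U n y - v y\<bar> \<le> \<eta>"
  proof eventually_elim
    case (elim n)
    show ?case
    proof
      fix y assume "y \<in> K"
      then obtain a where a: "a \<in> F" "y \<in> ball a \<delta>" using F(2) by blast
      define h where "h = y - a"
      have h: "norm h \<le> \<delta>" "y = a + h" using a by (auto simp: h_def dist_norm norm_minus_commute)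
      have "L * norm h \<le> \<bar>L\<bar> * \<delta>" using h by (intro mult_mono) auto
      then have "L * norm h \<le> \<eta> / 4" using L\<delta> by simp
      moreover have "\<bar>U n y - U n a\<bar> \<le> L * norm h" "\<bar>U n a - v a\<bar> \<le> \<eta> / 4"
        using elim a(1) h \<delta>(2) by auto
      moreover have "\<bar>v y - v a\<bar> \<le> L * norm h" using equi_lipschitz_limit[OF lip lim, of h a] h \<delta>(2) by simp
      ultimately show "\<bar>U n y - v y\<bar> \<le> \<eta>" using \<eta> by linarith
    qed
  qed
qed

text \<open>
A test function has compact support, so from some index on all $U_n$ satisfy the weak equation with
it. Pointwise convergence, together with the bounds on $U_n$ and $f(U_n)$, suffices for dominated
convergence on both sides.
\<close>

lemma weak_solution_limit:
  fixes U :: "nat \<Rightarrow> 'a::euclidean_space \<Rightarrow> real" and v :: "'a \<Rightarrow> real"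
  assumes f: "continuous_on UNIV f" and bdd: "\<And>n z. \<bar>U n z\<bar> \<le> M"
    and lim: "\<And>z. (\<lambda>n. U n z) \<longlonglongrightarrow> v z" and v: "continuous_on UNIV v"
    and weak: "\<And>r. \<forall>\<^sub>F n in sequentially. continuous_on (ball 0 r) (U n) \<and> weak_solution f (ball 0 r) (U n)"
  shows "weak_solution f UNIV v"
  unfolding weak_solution_iff
proof (intro allI impI)
  fix \<phi> :: "'a \<Rightarrow> real" assume \<phi>: "test_function UNIV \<phi>"
  define S where "S = closure {x. \<phi> x \<noteq> 0}"
  note T = test_function_D[OF \<phi>, folded S_def] test_function_laplacian[OF \<phi>, folded S_def]
  obtain r where r: "S \<subseteq> ball 0 r"
    using compact_imp_bounded[OF T(1)] bounded_subset_ballD[of S 0] by blast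
  have \<phi>r: "test_function (ball 0 r) \<phi>"
    using \<phi> r by (simp add: test_function_def S_def)
  have "compact (f ` {-M..M})"
    by (intro compact_continuous_image continuous_on_subset[OF f]) auto
  then obtain N where N: "\<And>s. \<bar>s\<bar> \<le> M \<Longrightarrow> \<bar>f s\<bar> \<le> N"
    by (force dest!: compact_imp_bounded simp: bounded_iff abs_le_iff)
  obtain n0 where n0: "\<And>n. n \<ge> n0 \<Longrightarrow> continuous_on (ball 0 r) (U n)"
    "\<And>n. n \<ge> n0 \<Longrightarrow> weak_solution f (ball 0 r) (U n)"
    using weak[of r] unfolding eventually_sequentially by blast
  have conv: "(\<lambda>n. LINT x|lborel. g (U (n + n0) x) * \<psi> x) \<longlonglongrightarrow> (LINT x|lborel. g (v x) * \<psi> x)"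
    if g: "continuous_on UNIV g" "\<And>s. \<bar>s\<bar> \<le> M \<Longrightarrow> \<bar>g s\<bar> \<le> B"
      and \<psi>: "continuous_on UNIV \<psi>" "\<And>x. x \<notin> S \<Longrightarrow> \<psi> x = 0" for g B and \<psi> :: "'a \<Rightarrow> real"
  proof (rule integral_dominated_convergence)
    have int: "integrable lborel (\<lambda>x. g (u x) * \<psi> x)" if "continuous_on S u" for u
      by (rule integrable_compact_support[OF T(1) continuous_on_compose2[OF g(1) that] \<psi>]) auto
    then show "(\<lambda>x. g (v x) * \<psi> x) \<in> borel_measurable lborel"
      using continuous_on_subset[OF v] by (intro borel_measurable_integrable) auto
    show "(\<lambda>x. g (U (n + n0) x) * \<psi> x) \<in> borel_measurable lborel" for n
      using continuous_on_subset[OF n0(1) r] by (intro borel_measurable_integrable int) auto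
    show "integrable lborel (\<lambda>x. B * \<bar>\<psi> x\<bar>)"
      using integrable_compact_support[OF T(1) continuous_on_const \<psi>, of 1] by simp
    show "AE x in lborel. (\<lambda>n. g (U (n + n0) x) * \<psi> x) \<longlonglongrightarrow> g (v x) * \<psi> x"
    proof (rule AE_I2)
      fix x
      have "isCont g (v x)" using g(1) by (simp add: continuous_on_eq_continuous_at)
      then show "(\<lambda>n. g (U (n + n0) x) * \<psi> x) \<longlonglongrightarrow> g (v x) * \<psi> x"
        by (intro tendsto_mult_right isCont_tendsto_compose[of _ g] LIMSEQ_ignore_initial_segment lim)
    qed
    show "AE x in lborel. norm (g (U (n + n0) x) * \<psi> x) \<le> B * \<bar>\<psi> x\<bar>" for n
      using g(2)[OF bdd] by (auto simp: abs_mult intro!: AE_I2 mult_right_mono)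
  qed
  have "(\<lambda>n. LINT x|lborel. U (n + n0) x * laplacian \<phi> x) \<longlonglongrightarrow> (LINT x|lborel. v x * laplacian \<phi> x)"
    using conv[of "\<lambda>s. s" M, OF _ _ T(6,7)] by simp
  moreover have "(\<lambda>n. LINT x|lborel. f (U (n + n0) x) * \<phi> x) \<longlonglongrightarrow> (LINT x|lborel. f (v x) * \<phi> x)"
    using conv[OF f N T(3,5)] by simp
  moreover have "(LINT x|lborel. U (n + n0) x * laplacian \<phi> x) = (LINT x|lborel. f (U (n + n0) x) * \<phi> x)" for n
    using n0(2)[of "n + n0"] \<phi>r by (simp add: weak_solution_iff)
  ultimately show "(LINT x|lborel. v x * laplacian \<phi> x) = (LINT x|lborel. f (v x) * \<phi> x)"
    using LIMSEQ_unique by simp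
qed

lemma entire_solutions_shift:
  assumes f: "continuous_on UNIV f" and "v \<in> entire_solutions f"
  shows "(\<lambda>x. v (x - a)) \<in> entire_solutions f"
proof -
  have v: "continuous_on UNIV v" "bounded (range v)" "weak_solution f UNIV v"
    using assms(2) by (auto simp: entire_solutions_def Cb_def)
  have "continuous_on UNIV (\<lambda>x. v (x - a))"
    by (rule continuous_on_compose2[OF v(1)]) (auto intro!: continuous_intros)
  moreover have "bounded (range (\<lambda>x. v (x - a)))"
    by (rule bounded_subset[OF v(2)]) auto
  moreover have "weak_solution f UNIV (\<lambda>x. v (x - a))"
    using weak_solution_shift[OF v(1,3) f, of a] by simp
  ultimately show ?thesis by (simp add: entire_solutions_def Cb_def)
qed

text \<open>
Otherwise there are solutions on balls of radii tending to infinity that stay $\eta$-far from all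
entire solutions on the unit ball. Translating the centres to the origin and extracting a limit gives
an entire solution that is uniformly close to one of them.
\<close>

lemma approximation_by_entire_solutions:
  fixes f :: "real \<Rightarrow> real"
  assumes f: "continuous_on UNIV f" "\<epsilon> > 0" "\<And>s. f s * s \<ge> - C + \<bar>s\<bar> powr (2 + \<epsilon>)" and \<eta>: "\<eta> > 0"
  obtains R where "R > 0" "\<And>(x::'a::euclidean_space) u. continuous_on (ball x R) u \<Longrightarrow>
    weak_solution f (ball x R) u \<Longrightarrow> \<exists>v\<in>entire_solutions f. \<forall>y\<in>cball x 1. \<bar>u y - v y\<bar> \<le> \<eta>"
proof (rule ccontr)
  note found = that
  assume "\<not> thesis"
  then have "\<exists>(x::'a) u. continuous_on (ball x R) u \<and> weak_solution f (ball x R) u \<and>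
      \<not> (\<exists>v\<in>entire_solutions f. \<forall>y\<in>cball x 1. \<bar>u y - v y\<bar> \<le> \<eta>)" if "R > 0" for R
    using found[OF that] by blast
  \<comment> \<open>The pointwise bound costs 1 of the radius and the Lipschitz bound 2 more, so both hold on the ball of radius $n + 2$.\<close>
  then have "\<exists>(x::'a) u. continuous_on (ball x (real n + 5)) u \<and> weak_solution f (ball x (real n + 5)) u \<and>
      \<not> (\<exists>v\<in>entire_solutions f. \<forall>y\<in>cball x 1. \<bar>u y - v y\<bar> \<le> \<eta>)" for n :: nat by simp
  then obtain x :: "nat \<Rightarrow> 'a" and u where u: "\<And>n. continuous_on (ball (x n) (real n + 5)) (u n)"
    "\<And>n. weak_solution f (ball (x n) (real n + 5)) (u n)"
    and far: "\<And>n v. v \<in> entire_solutions f \<Longrightarrow> \<not> (\<forall>y\<in>cball (x n) 1. \<bar>u n y - v y\<bar> \<le> \<eta>)"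
    by metis
  obtain A where A: "\<And>V u (x::'a::euclidean_space). open V \<Longrightarrow> continuous_on V u \<Longrightarrow>
    weak_solution f V u \<Longrightarrow> cball x 1 \<subseteq> V \<Longrightarrow> \<bar>u x\<bar> \<le> A"
    using weak_solution_interior_bound[OF f, where ?'a='a] by metis
  obtain L where L: "\<And>V u (x::'a::euclidean_space) h. open V \<Longrightarrow> continuous_on V u \<Longrightarrow>
    weak_solution f V u \<Longrightarrow> cball x 2 \<subseteq> V \<Longrightarrow> (\<And>y. y \<in> cball x 2 \<Longrightarrow> \<bar>u y\<bar> \<le> A) \<Longrightarrow>
    norm h \<le> 1 \<Longrightarrow> \<bar>u (x + h) - u x\<bar> \<le> L * norm h"
    using weak_solution_interior_lipschitz[OF f(1), where ?'a='a] by metis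
  define W where "W = (\<lambda>n z. u n (z + x n))"
  have W: "continuous_on (ball 0 (real n + 5)) (W n)" "weak_solution f (ball 0 (real n + 5)) (W n)" for n
  proof -
    have eq: "{z. z - (- x n) \<in> ball (x n) (real n + 5)} = ball 0 (real n + 5)"
      by (auto simp: dist_norm)
    show "weak_solution f (ball 0 (real n + 5)) (W n)"
      using weak_solution_shift[OF u(1)[of n] u(2)[of n] f(1), of "- x n", unfolded eq] by (simp add: W_def)
    show "continuous_on (ball 0 (real n + 5)) (W n)"
      unfolding W_def by (rule continuous_on_compose2[OF u(1)[of n]]) (auto intro!: continuous_intros simp: dist_norm)
  qed
  have WA: "\<bar>W n z\<bar> \<le> A" if "norm z < real n + 4" for n z
  proof (rule A[OF open_ball W])
    show "cball z 1 \<subseteq> ball 0 (real n + 5)"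
    proof
      fix y assume "y \<in> cball z 1"
      then show "y \<in> ball 0 (real n + 5)"
        using that norm_triangle_sub[of y z] by (simp add: dist_norm norm_minus_commute)
    qed
  qed
  have WL: "\<bar>W n (z + h) - W n z\<bar> \<le> L * norm h" if "norm z < real n + 2" "norm h \<le> 1" for n z h
  proof (rule L[OF open_ball W _ _ that(2)])
    have *: "norm y < real n + 4" if "y \<in> cball z 2" for y
      using that \<open>norm z < real n + 2\<close> norm_triangle_sub[of y z] by (simp add: dist_norm norm_minus_commute)
    show "cball z 2 \<subseteq> ball 0 (real n + 5)" using * by force
    show "\<bar>W n y\<bar> \<le> A" if "y \<in> cball z 2" for y using WA *[OF that] by blast
  qed
  \<comment> \<open>Cutting off outside the region of the interior bound makes the bound hold everywhere, as the extraction of a subsequence requires.\<close>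
  define U where "U = (\<lambda>n z. if norm z < real n + 4 then W n z else 0)"
  have A0: "A \<ge> 0" using WA[of 0 0] by auto
  have bdd: "\<bar>U n z\<bar> \<le> A" for n z using WA A0 by (simp add: U_def)
  have ev: "\<forall>\<^sub>F n in sequentially. r < real n + 2" for r
  proof -
    obtain n0 :: nat where "r < real n0" using reals_Archimedean2 by blast
    then show ?thesis unfolding eventually_sequentially by (intro exI[of _ n0]) auto
  qed
  have lip: "\<forall>\<^sub>F n in sequentially. \<forall>h. norm h \<le> 1 \<longrightarrow> \<bar>U n (z + h) - U n z\<bar> \<le> L * norm h" for z
    using ev[of "norm z"]
  proof eventually_elim
    case (elim n)
    show ?case
    proof (intro allI impI)
      fix h :: 'a assume h: "norm h \<le> 1"
      have "norm (z + h) < real n + 4" using norm_triangle_ineq[of z h] elim h by linarith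
      then show "\<bar>U n (z + h) - U n z\<bar> \<le> L * norm h" using WL[OF elim h] elim by (simp add: U_def)
    qed
  qed
  have weak: "\<forall>\<^sub>F n in sequentially. continuous_on (ball 0 r) (U n) \<and> weak_solution f (ball 0 r) (U n)" for r
    using ev[of r]
  proof eventually_elim
    case (elim n)
    have sub: "ball (0::'a) r \<subseteq> ball 0 (real n + 5)" using elim by auto
    have eq: "U n z = W n z" if "z \<in> ball 0 r" for z using that elim by (simp add: U_def)
    have "continuous_on (ball 0 r) (U n)"
      using continuous_on_subset[OF W(1) sub] by (rule continuous_on_eq) (simp add: eq)
    moreover have "weak_solution f (ball 0 r) (U n)"
      using weak_solution_subset[OF W(2) sub] eq by (rule weak_solution_cong)
    ultimately show ?case ..
  qed
  obtain k v where k: "strict_mono (k::nat \<Rightarrow> nat)" and lim: "\<And>z. (\<lambda>n. U (k n) z) \<longlonglongrightarrow> v z"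
    using equi_lipschitz_subsequence[OF bdd lip] by metis
  note lip' = eventually_subseq[OF k lip]
  have vlip: "\<bar>v (z + h) - v z\<bar> \<le> L * norm h" if "norm h \<le> 1" for z h
    by (rule equi_lipschitz_limit[OF lip' lim that])
  have "continuous_on UNIV v"
    unfolding continuous_on_iff
  proof (intro ballI allI impI)
    fix z :: 'a and e :: real assume "e > 0"
    show "\<exists>d>0. \<forall>y\<in>UNIV. dist y z < d \<longrightarrow> dist (v y) (v z) < e"
    proof (intro exI conjI ballI impI)
      show pos: "min 1 (e / (\<bar>L\<bar> + 1)) > 0" using \<open>e > 0\<close> by simp
      fix y assume y: "dist y z < min 1 (e / (\<bar>L\<bar> + 1))"
      then have "\<bar>v (z + (y - z)) - v z\<bar> \<le> L * norm (y - z)"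
        by (intro vlip) (simp add: dist_norm)
      also have "\<dots> \<le> (\<bar>L\<bar> + 1) * norm (y - z)" by (intro mult_right_mono) auto
      also have "\<dots> < (\<bar>L\<bar> + 1) * (e / (\<bar>L\<bar> + 1))"
        using y by (intro mult_strict_left_mono) (auto simp: dist_norm)
      finally show "dist (v y) (v z) < e" by (simp add: dist_real_def)
    qed
  qed
  moreover have "\<bar>v z\<bar> \<le> A" for z
    by (rule tendsto_upperbound[OF tendsto_rabs[OF lim[of z]]]) (auto simp: bdd)
  then have "bounded (range v)" by (auto simp: bounded_iff)
  moreover have "weak_solution f UNIV v"
    by (rule weak_solution_limit[OF f(1) bdd lim calculation(1) eventually_subseq[OF k weak]])
  ultimately have v: "v \<in> entire_solutions f" by (simp add: entire_solutions_def Cb_def)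
  obtain n where n: "\<And>y. y \<in> cball 0 1 \<Longrightarrow> \<bar>U (k n) y - v y\<bar> \<le> \<eta>"
    using eventually_happens[OF equi_lipschitz_uniform_on_compact[OF lip' lim compact_cball[of 0 1] \<eta>]] by force
  have "\<bar>u (k n) y - v (y - x (k n))\<bar> \<le> \<eta>" if "y \<in> cball (x (k n)) 1" for y
  proof -
    have y: "norm (y - x (k n)) \<le> 1" using that by (simp add: dist_norm norm_minus_commute)
    then have "U (k n) (y - x (k n)) = u (k n) y" by (simp add: U_def W_def)
    then show ?thesis using n[of "y - x (k n)"] y by simp
  qed
  then show False using far[OF entire_solutions_shift[OF f(1) v]] by blast
qed

section \<open>Attraction to the entire solutions\<close>

text \<open>
A segment from \<open>x\<close> to a point outside \<open>\<Omega>\<close> meets the frontier.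
\<close>

lemma ball_subset_if_edist_frontier:
  fixes x :: "'a::euclidean_space"
  assumes "x \<in> \<Omega>" "ereal D \<le> edist_set x (frontier \<Omega>)"
  shows "ball x D \<subseteq> \<Omega>"
proof
  fix y assume y: "y \<in> ball x D"
  show "y \<in> \<Omega>"
  proof (rule ccontr)
    assume "y \<notin> \<Omega>"
    then have "closed_segment x y \<inter> frontier \<Omega> \<noteq> {}"
      using assms(1) by (intro connected_Int_frontier) auto
    then obtain z where z: "z \<in> closed_segment x y" "z \<in> frontier \<Omega>" by blast
    have "edist_set x (frontier \<Omega>) \<le> ereal (dist x z)"
      unfolding edist_set_def by (rule INF_lower[OF z(2)])
    with assms(2) have "D \<le> dist x z" by (metis ereal_less_eq(3) order_trans)
    moreover have "dist x z \<le> dist x y"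
      using segment_bound(1)[OF z(1)] by (simp add: dist_norm norm_minus_commute)
    ultimately show False using y by simp
  qed
qed

lemma edist_set_real:
  assumes "V \<noteq> {}"
  obtains r where "edist_set x V = ereal r"
proof -
  obtain y where "y \<in> V" using assms by blast
  then have "edist_set x V \<le> ereal (dist x y)"
    unfolding edist_set_def by (rule INF_lower)
  moreover have "0 \<le> edist_set x V"
    unfolding edist_set_def by (rule INF_greatest) simp
  ultimately show thesis using that by (cases "edist_set x V") auto
qed

definition approximable :: "(real \<Rightarrow> real) \<Rightarrow> real \<Rightarrow> ('a::euclidean_space \<Rightarrow> real) \<Rightarrow> 'a \<Rightarrow> bool" where
  "approximable f \<eta> u x \<longleftrightarrow> (\<exists>v\<in>entire_solutions f. \<forall>y\<in>cball x 1. \<bar>u y - v y\<bar> \<le> \<eta>)"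

lemma sup_dist_set_le_if_approximable:
  assumes "approximable f \<eta> u x"
  shows "sup_dist_set (cball x 1) (restrict u (cball x 1))
    ((\<lambda>v. restrict v (cball x 1)) ` entire_solutions f) \<le> ereal \<eta>"
proof -
  obtain v where v: "v \<in> entire_solutions f" "\<And>y. y \<in> cball x 1 \<Longrightarrow> \<bar>u y - v y\<bar> \<le> \<eta>"
    using assms by (auto simp: approximable_def)
  have "sup_norm_on (cball x 1) (\<lambda>y. restrict u (cball x 1) y - restrict v (cball x 1) y) \<le> ereal \<eta>"
    unfolding sup_norm_on_def by (rule SUP_least) (use v(2) in simp)
  then show ?thesis
    unfolding sup_dist_set_def
    by (intro INF_lower2[where i="restrict v (cball x 1)"] imageI v(1))
qed

text \<open>
All admissible accuracies for solutions in balls of radius at least \<open>z\<close>. The accuracies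
refer to one dimension, which no value argument mentions; hence the type argument.
\<close>

definition attraction_levels :: "(real \<Rightarrow> real) \<Rightarrow> 'a::euclidean_space itself \<Rightarrow> real \<Rightarrow> real set" where
  "attraction_levels f _ z = {\<eta>. \<eta> \<ge> 0 \<and> (\<forall>(x::'a) u r. r \<ge> z \<longrightarrow> r > 2 \<longrightarrow>
     continuous_on (ball x r) u \<longrightarrow> weak_solution f (ball x r) u \<longrightarrow> approximable f \<eta> u x)}"

theorem corollary3p7:
  fixes \<Omega> :: "'a::euclidean_space set"
    and f :: "real \<Rightarrow> real"
    and C \<epsilon> :: real
    and k :: nat
  assumes "open \<Omega>" and "connected \<Omega>" and "\<not> bounded \<Omega>"
    and "k \<ge> 1" and "Ck_boundary k \<Omega>"
    and "\<And>D. D > 0 \<Longrightarrow> \<exists>h\<in>\<Omega>. edist_set h (frontier \<Omega>) \<ge> ereal D"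
    and "continuous_on UNIV f"
    and "\<epsilon> > 0"
    and "\<And>s. f s * s \<ge> - C + \<bar>s\<bar> powr (2 + \<epsilon>)"
  shows "\<exists>\<alpha> :: real \<Rightarrow> real.
    (\<forall>z\<ge>0. \<alpha> z \<ge> 0) \<and> antimono_on {0..} \<alpha> \<and> (\<alpha> \<longlongrightarrow> 0) at_top \<and>
    (\<forall>u \<in> Cb \<Omega>. \<forall>u0 \<in> Cb (frontier \<Omega>).
       weak_solution f \<Omega> u \<and> (\<forall>y \<in> frontier \<Omega>. (u \<longlongrightarrow> u0 y) (at y within \<Omega>)) \<longrightarrow>
       (\<forall>x \<in> \<Omega>. edist_set x (frontier \<Omega>) > 2 \<longrightarrow>
          sup_dist_set (cball x 1) (restrict u (cball x 1))
            ((\<lambda>v. restrict v (cball x 1)) ` entire_solutions f)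
          \<le> extend_at_infinity \<alpha> (edist_set x (frontier \<Omega>))))"
proof (cases "\<exists>u \<in> Cb \<Omega>. weak_solution f \<Omega> u")
  case False
  then show ?thesis
    by (intro exI[of _ "\<lambda>_. 0"]) (auto simp: monotone_on_def)
next
  case True
  note f = assms(7,8,9)
  have eventually_approximable: "\<exists>R>0. \<forall>(x::'a) u. continuous_on (ball x R) u \<longrightarrow>
      weak_solution f (ball x R) u \<longrightarrow> approximable f \<eta> u x" if "\<eta> > 0" for \<eta>
    using approximation_by_entire_solutions[OF f that, where ?'a='a]
    unfolding approximable_def by metis
  \<comment> \<open>The distance to an empty set would be infinite; large balls in \<open>\<Omega>\<close> provide an entire solution.\<close>
  have "(entire_solutions f :: ('a \<Rightarrow> real) set) \<noteq> {}"
  proof -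
    obtain R where R: "R > 0" "\<And>(x::'a) u. continuous_on (ball x R) u \<Longrightarrow>
      weak_solution f (ball x R) u \<Longrightarrow> approximable f 1 u x"
      using eventually_approximable[of 1] by auto
    obtain h where "h \<in> \<Omega>" "edist_set h (frontier \<Omega>) \<ge> ereal R"
      using assms(6)[OF R(1)] by blast
    then have sub: "ball h R \<subseteq> \<Omega>" by (rule ball_subset_if_edist_frontier)
    obtain u where "u \<in> Cb \<Omega>" "weak_solution f \<Omega> u" using True by blast
    then have "approximable f 1 u h"
      using sub by (intro R(2) weak_solution_subset[OF _ sub]) (auto simp: Cb_def intro: continuous_on_subset)
    then show ?thesis by (auto simp: approximable_def)
  qed
  then obtain v0 :: "'a \<Rightarrow> real" and B where v0: "v0 \<in> entire_solutions f" "\<And>y. \<bar>v0 y\<bar> \<le> B"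
    by (force simp: entire_solutions_def Cb_def bounded_iff)
  obtain A where A: "\<And>V u (x::'a). open V \<Longrightarrow> continuous_on V u \<Longrightarrow>
    weak_solution f V u \<Longrightarrow> cball x 1 \<subseteq> V \<Longrightarrow> \<bar>u x\<bar> \<le> A"
    using weak_solution_interior_bound[OF f, where ?'a='a] by metis
  define E where "E = attraction_levels f TYPE('a)"
  define \<alpha> where "\<alpha> = (\<lambda>z. Inf (E z))"
  have E_approx: "approximable f \<eta> u x"
    if "\<eta> \<in> E z" "r \<ge> z" "r > 2" "continuous_on (ball x r) u" "weak_solution f (ball x r) u"
    for \<eta> z r u and x :: 'a
    using that unfolding E_def attraction_levels_def by blast
  have "max 0 (A + B) \<in> E z" for z
    unfolding E_def attraction_levels_def mem_Collect_eq
  proof (intro conjI allI impI)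
    fix x :: 'a and u :: "'a \<Rightarrow> real" and r
    assume r: "r > 2" and u: "continuous_on (ball x r) u" "weak_solution f (ball x r) u"
    have "\<bar>u y - v0 y\<bar> \<le> max 0 (A + B)" if "y \<in> cball x 1" for y
    proof -
      have "cball y 1 \<subseteq> ball x r"
      proof
        fix z assume "z \<in> cball y 1"
        then show "z \<in> ball x r" using that r dist_triangle[of x z y] by simp
      qed
      then have "\<bar>u y\<bar> \<le> A" by (rule A[OF open_ball u])
      then show ?thesis using v0(2)[of y] by linarith
    qed
    then show "approximable f (max 0 (A + B)) u x"
      unfolding approximable_def using v0(1) by blast
  qed simp
  then have E_ne: "E z \<noteq> {}" for z by blast
  have E_nonneg: "\<eta> \<ge> 0" if "\<eta> \<in> E z" for \<eta> z
    using that by (simp add: E_def attraction_levels_def)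
  then have E_bdd: "bdd_below (E z)" for z by (rule bdd_belowI)
  have E_mono: "E z \<subseteq> E z'" if "z \<le> z'" for z z'
    using order_trans[OF that] unfolding E_def attraction_levels_def by blast
  have \<alpha>_nonneg: "\<alpha> z \<ge> 0" for z
    unfolding \<alpha>_def by (rule cInf_greatest[OF E_ne E_nonneg])
  have "antimono_on {0..} \<alpha>"
    unfolding \<alpha>_def by (intro monotone_onI cInf_superset_mono E_ne E_bdd E_mono)
  moreover have "(\<alpha> \<longlongrightarrow> 0) at_top"
  proof (rule tendstoI)
    fix e :: real assume "e > 0"
    then obtain R where R: "\<And>(x::'a) u. continuous_on (ball x R) u \<Longrightarrow>
      weak_solution f (ball x R) u \<Longrightarrow> approximable f (e / 2) u x"
      using eventually_approximable[of "e / 2"] by auto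
    have "e / 2 \<in> E z" if "z \<ge> R" for z
      unfolding E_def attraction_levels_def mem_Collect_eq
    proof (intro conjI allI impI)
      fix x :: 'a and u :: "'a \<Rightarrow> real" and r
      assume "r \<ge> z" and u: "continuous_on (ball x r) u" "weak_solution f (ball x r) u"
      then have sub: "ball x R \<subseteq> ball x r" using that by auto
      show "approximable f (e / 2) u x"
        by (rule R[OF continuous_on_subset[OF u(1) sub] weak_solution_subset[OF u(2) sub]])
    qed (use \<open>e > 0\<close> in simp)
    then have "\<alpha> z \<le> e / 2" if "z \<ge> R" for z
      unfolding \<alpha>_def using that by (intro cInf_lower E_bdd) auto
    then have "dist (\<alpha> z) 0 < e" if "z \<ge> R" for z
      using that \<alpha>_nonneg[of z] \<open>e > 0\<close> by fastforce
    then show "\<forall>\<^sub>F z in at_top. dist (\<alpha> z) 0 < e"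
      using eventually_at_top_linorder by blast
  qed
  moreover have "sup_dist_set (cball x 1) (restrict u (cball x 1))
        ((\<lambda>v. restrict v (cball x 1)) ` entire_solutions f)
      \<le> extend_at_infinity \<alpha> (edist_set x (frontier \<Omega>))"
    if u: "u \<in> Cb \<Omega>" "weak_solution f \<Omega> u" and x: "x \<in> \<Omega>" "edist_set x (frontier \<Omega>) > 2" for u x
  proof (cases "frontier \<Omega> = {}")
    case True
    then have "\<Omega> = UNIV" using x(1) frontier_eq_empty by blast
    then have "approximable f 0 u x"
      using u by (auto simp: approximable_def entire_solutions_def intro!: bexI[of _ u])
    moreover have "edist_set x (frontier \<Omega>) = \<infinity>"
      using True by (simp add: edist_set_def top_ereal_def)
    ultimately show ?thesis
      using sup_dist_set_le_if_approximable by (fastforce simp: extend_at_infinity_def zero_ereal_def)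
  next
    case False
    then obtain r where r: "edist_set x (frontier \<Omega>) = ereal r" by (rule edist_set_real)
    have r2: "r > 2" using x(2) unfolding r by simp
    have sub: "ball x r \<subseteq> \<Omega>"
      by (rule ball_subset_if_edist_frontier[OF x(1)]) (simp add: r)
    have ur: "continuous_on (ball x r) u" "weak_solution f (ball x r) u"
      using u sub by (auto simp: Cb_def intro: continuous_on_subset weak_solution_subset)
    have "sup_dist_set (cball x 1) (restrict u (cball x 1))
        ((\<lambda>v. restrict v (cball x 1)) ` entire_solutions f) \<le> ereal (\<alpha> r)"
    proof (rule ereal_le_epsilon2)
      fix e :: real assume "e > 0"
      then have "Inf (E r) < \<alpha> r + e" by (simp add: \<alpha>_def)
      then obtain \<eta> where \<eta>: "\<eta> \<in> E r" "\<eta> < \<alpha> r + e" using cInf_lessD[OF E_ne] by blast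
      have "approximable f \<eta> u x" by (rule E_approx[OF \<eta>(1) order_refl r2 ur])
      from sup_dist_set_le_if_approximable[OF this]
      show "sup_dist_set (cball x 1) (restrict u (cball x 1))
        ((\<lambda>v. restrict v (cball x 1)) ` entire_solutions f) \<le> ereal (\<alpha> r) + ereal e"
        by (rule order_trans) (use \<eta>(2) in simp)
    qed
    then show ?thesis by (simp add: r extend_at_infinity_def)
  qed
  ultimately show ?thesis using \<alpha>_nonneg by blast
qed

end
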